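(* Let $(X,f)$ be a Cantor minimal homeomorphism, i.e. $X$ is a Cantor set and $f:X\to X$ is a minimal homeomorphism. Then the topological rank of $(X,f)$ defined by Bratteli diagrams and the topological rank of $(X,f)$ defined by GM-coverings coincide.
   Context: I. Rank by Bratteli diagrams. A Bratteli diagram is an infinite directed graph $(V,E)$ with partitions into non-empty finite sets $V=V_0\cup V_1\cup\cdots$, $E=E_1\cup E_2\cup\cdots$, $V_0=\{v_0\}$, with source and range maps $s:E_n\to V_{n-1}$, $r:E_n\to V_n$ such that $s^{-1}(v)\neq\emptyset$ for all $v\in V$ and $r^{-1}(v)\ne\emptyset$ for all $v\in V\setminus V_0$ (multiple edges allowed). Its rank is $\liminf_{n\to\infty}\#V_n$. Telescoping: for $m<n$ replace the levels strictly between $m$ and $n$ by keeping $V_m,V_n$ and using as edges all paths from $V_m$ to $V_n$. The diagram is simple if, after at most countably many telescopings, every $u\in V_n$ and $v\in V_{n+1}$ are joined by at least one edge, for all $n\ge0$. An ordered Bratteli diagram carries a partial order on $E$ for which $e,e'$ are comparable iff $r(e)=r(e')$ (so each $r^{-1}(v)$ is linearly ordered). An infinite path is maximal (minimal) if all its edges are maximal (minimal) in their sets $r^{-1}(v)$. The diagram is properly ordered if it is simple and has a unique maximal infinite path $x_{\max}$ and a unique minimal infinite path $x_{\min}$. Let $E_{0,\infty}=\{(e_1,e_2,\dots):e_i\in E_i,\ r(e_i)=s(e_{i+1})\}$ with the subspace topology from $\prod_iE_i$. The Vershik map $\phi:E_{0,\infty}\to E_{0,\infty}$ is: $\phi(x_{\max})=x_{\min}$;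 for $e\ne x_{\max}$, let $n$ be least such that $e_n$ is not maximal in $r^{-1}(r(e_n))$, let $f_n$ be the successor of $e_n$ there, let $(f_1,\dots,f_{n-1})$ be the path of minimal edges from $v_0$ to $s(f_n)$, and set $\phi(e)=(f_1,\dots,f_n,e_{n+1},e_{n+2},\dots)$. The topological rank of $(X,f)$ defined by Bratteli diagrams is the minimum of the ranks in $[1,\infty]$ of properly ordered Bratteli diagrams whose Vershik system $(E_{0,\infty},\phi)$ is topologically conjugate to $(X,f)$. II. Rank by GM-coverings. A graph $G=(V,E)$ is a finite directed graph with $E\subseteq V\times V$ such that every vertex has at least one incoming and one outgoing edge. A graph homomorphism $\varphi:G_1\to G_2$ is a map $V_1\to V_2$ sending edges to edges; it is edge-surjective if $\varphi(E_1)=E_2$, and $+$directional if $(u,v),(u,v')\in E_1$ implies $\varphi(v)=\varphi(v')$. A cover is a $+$directional edge-surjective graph homomorphism. A covering is a sequence of covers $G_0\xleftarrow{\varphi_0}G_1\xleftarrow{\varphi_1}G_2\xleftarrow{\varphi_2}\cdots$ with $\varphi_n:G_{n+1}\to G_n$ and $G_0=(\{v_0\},\{(v_0,v_0)\})$; $\varphi_{m,n}=\varphi_n\circ\cdots\circ\varphi_{m-1}$ for $m>n$. Its inverse limit is the system with space $V_{\mathcal G}=\{(x_i)_{i\ge0}\in\prod_iV_i:x_i=\varphi_i(x_{i+1})\ \forall i\}$ (product topology), and with map whose graph is $\{(x,y)\in V_{\mathcal G}\times V_{\mathcal G}:(x_i,y_i)\in E_i\ \forall i\}$ (this is the graph of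 a continuous surjection). A circuit of period $l\ge1$ is a walk $(v_0,\dots,v_l)$ along edges with $v_0=v_l$ and $v_0,\dots,v_{l-1}$ distinct. $E(w)$ is the set of edges of a walk $w$. A GM-covering (covering of Gambaudo--Martens type) is a covering such that for each $n>0$ there are a vertex $v_{n,0}$ of $G_n$ and finitely many pairwise distinct circuits $c_{n,i}$ $(1\le i\le l_n)$ with: (a) $c_{n,i}=(v_{n,0}=v_{n,i,0},v_{n,i,1},\dots,v_{n,i,l(n,i)}=v_{n,0})$, $l(n,i)\ge1$; (b) $\bigcup_iE(c_{n,i})=E(G_n)$; (c) if $v_{n,i,j}=v_{n,i',j'}$ with $j,j'\ge1$, then $v_{n,i,j+k}=v_{n,i',j'+k}$ for $k=0,1,2,\dots$ until $j+k=l(n,i)$ and $j'+k=l(n,i')$ at the same time; (d) $\varphi_n(v_{n+1,0})=v_{n,0}$; (e) $\varphi_n(v_{n+1,i,1})=v_{n,1,1}$ for all $1\le i\le l_{n+1}$. It is simple if for all $n>0$ there is $m>n$ with $E(\varphi_{m,n}(c_{m,i}))=E(G_n)$ for each $1\le i\le l_m$. Its rank is $\liminf_{n\to\infty}l_n\in[1,\infty]$. The topological rank of $(X,f)$ defined by GM-coverings is the minimum of the ranks of simple GM-coverings whose inverse limit is topologically conjugate to $(X,f)$. *)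

theory Defs
  imports
    "HOL-Analysis.Analysis"
    "HOL-Library.Extended_Nat"
    "HOL-Library.Liminf_Limsup"
    "HOL-Library.Disjoint_Sets"
    "Graph_Theory.Pair_Digraph"
    "Graph_Theory.Vertex_Walk"
begin

section \<open>Topological dynamics\<close>

definition cantor_set :: "'a topology \<Rightarrow> bool" where
  "cantor_set X \<longleftrightarrow>
     X homeomorphic_space
       product_topology (\<lambda>_::nat. discrete_topology (UNIV :: bool set)) UNIV"

definition minimal_map :: "'a topology \<Rightarrow> ('a \<Rightarrow> 'a) \<Rightarrow> bool" where
  "minimal_map X f \<longleftrightarrow>
     (\<forall>A. closedin X A \<and> f ` A \<subseteq> A \<longrightarrow> A = {} \<or> A = topspace X)"

definition topologically_conjugate ::
  "'a topology \<Rightarrow> ('a \<Rightarrow> 'a) \<Rightarrow> 'b topology \<Rightarrow> ('b \<Rightarrow> 'b) \<Rightarrow> bool" where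
  "topologically_conjugate X f Y g \<longleftrightarrow>
     (\<exists>h. homeomorphic_map X Y h \<and> (\<forall>x\<in>topspace X. h (f x) = g (h x)))"


section \<open>Bratteli diagrams\<close>

text \<open>
  The field \<open>bd_E\<close> is shifted by one against the usual numbering: \<open>bd_E B n\<close> is the edge
  set \<open>E\<^sub>n\<^sub>+\<^sub>1\<close>, whose edges lead from \<open>bd_V B n\<close> to \<open>bd_V B (Suc n)\<close>. Accordingly the
  entry \<open>x n\<close> of an infinite path \<open>x\<close> is its edge in \<open>E\<^sub>n\<^sub>+\<^sub>1\<close>.
\<close>

record ('v, 'e) bratteli_diagram =
  bd_V :: "nat \<Rightarrow> 'v set"
  bd_E :: "nat \<Rightarrow> 'e set"
  bd_src :: "'e \<Rightarrow> 'v"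
  bd_rng :: "'e \<Rightarrow> 'v"

definition bd_edges :: "('v, 'e, 'x) bratteli_diagram_scheme \<Rightarrow> 'e set" where
  "bd_edges B = (\<Union>n. bd_E B n)"

definition is_bratteli_diagram :: "('v, 'e, 'x) bratteli_diagram_scheme \<Rightarrow> bool" where
  "is_bratteli_diagram B \<longleftrightarrow>
     disjoint_family (bd_V B) \<and> disjoint_family (bd_E B) \<and>
     (\<forall>n. finite (bd_V B n) \<and> bd_V B n \<noteq> {}) \<and>
     (\<forall>n. finite (bd_E B n) \<and> bd_E B n \<noteq> {}) \<and>
     (\<exists>v0. bd_V B 0 = {v0}) \<and>
     (\<forall>n. \<forall>e\<in>bd_E B n. bd_src B e \<in> bd_V B n \<and> bd_rng B e \<in> bd_V B (Suc n)) \<and>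
     (\<forall>n. \<forall>v\<in>bd_V B n. \<exists>e\<in>bd_edges B. bd_src B e = v) \<and>
     (\<forall>n. \<forall>v\<in>bd_V B (Suc n). \<exists>e\<in>bd_edges B. bd_rng B e = v)"

definition bd_rank :: "('v, 'e, 'x) bratteli_diagram_scheme \<Rightarrow> enat" where
  "bd_rank B = liminf (\<lambda>n. enat (card (bd_V B n)))"

definition bd_finite_paths ::
  "('v, 'e, 'x) bratteli_diagram_scheme \<Rightarrow> nat \<Rightarrow> nat \<Rightarrow> 'e list set" where
  "bd_finite_paths B m n =
     {p. length p = n - m \<and>
         (\<forall>i<length p. p ! i \<in> bd_E B (m + i)) \<and>
         (\<forall>i. Suc i < length p \<longrightarrow> bd_rng B (p ! i) = bd_src B (p ! Suc i))}"

text \<open>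
  Carrying out countably many telescopings amounts to keeping the levels
  \<open>0 = t 0 < t 1 < t 2 < \<dots>\<close> and taking as edges the paths between consecutive kept levels
  (level \<open>0\<close> never lies strictly between two levels, so it is always kept).
\<close>

definition bd_telescope ::
  "(nat \<Rightarrow> nat) \<Rightarrow> ('v, 'e, 'x) bratteli_diagram_scheme \<Rightarrow> ('v, 'e list) bratteli_diagram" where
  "bd_telescope t B =
     \<lparr> bd_V = (\<lambda>k. bd_V B (t k)),
       bd_E = (\<lambda>k. bd_finite_paths B (t k) (t (Suc k))),
       bd_src = (\<lambda>p. bd_src B (hd p)),
       bd_rng = (\<lambda>p. bd_rng B (last p)) \<rparr>"

definition bd_fully_connected :: "('v, 'e, 'x) bratteli_diagram_scheme \<Rightarrow> bool" where
  "bd_fully_connected B \<longleftrightarrow>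
     (\<forall>n. \<forall>u\<in>bd_V B n. \<forall>v\<in>bd_V B (Suc n). \<exists>e\<in>bd_E B n. bd_src B e = u \<and> bd_rng B e = v)"

definition bd_simple :: "('v, 'e, 'x) bratteli_diagram_scheme \<Rightarrow> bool" where
  "bd_simple B \<longleftrightarrow>
     (\<exists>t. strict_mono t \<and> t 0 = 0 \<and> bd_fully_connected (bd_telescope t B))"

definition bd_paths :: "('v, 'e, 'x) bratteli_diagram_scheme \<Rightarrow> (nat \<Rightarrow> 'e) set" where
  "bd_paths B =
     {x. \<forall>i. x i \<in> bd_E B i \<and> bd_rng B (x i) = bd_src B (x (Suc i))}"

definition bd_path_space ::
  "('v, 'e, 'x) bratteli_diagram_scheme \<Rightarrow> (nat \<Rightarrow> 'e) topology" where
  "bd_path_space B =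
     subtopology (product_topology (\<lambda>i. discrete_topology (bd_E B i)) UNIV) (bd_paths B)"

record ('v, 'e) ordered_bratteli_diagram = "('v, 'e) bratteli_diagram" +
  bd_le :: "'e rel"

definition is_ordered_bratteli_diagram ::
  "('v, 'e, 'x) ordered_bratteli_diagram_scheme \<Rightarrow> bool" where
  "is_ordered_bratteli_diagram B \<longleftrightarrow>
     is_bratteli_diagram B \<and>
     partial_order_on (bd_edges B) (bd_le B) \<and>
     (\<forall>e\<in>bd_edges B. \<forall>e'\<in>bd_edges B.
        ((e, e') \<in> bd_le B \<or> (e', e) \<in> bd_le B) \<longleftrightarrow> bd_rng B e = bd_rng B e')"

definition bd_max_edge :: "('v, 'e, 'x) ordered_bratteli_diagram_scheme \<Rightarrow> 'e \<Rightarrow> bool" where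
  "bd_max_edge B e \<longleftrightarrow>
     (\<forall>e'\<in>bd_edges B. bd_rng B e' = bd_rng B e \<and> (e, e') \<in> bd_le B \<longrightarrow> e' = e)"

definition bd_min_edge :: "('v, 'e, 'x) ordered_bratteli_diagram_scheme \<Rightarrow> 'e \<Rightarrow> bool" where
  "bd_min_edge B e \<longleftrightarrow>
     (\<forall>e'\<in>bd_edges B. bd_rng B e' = bd_rng B e \<and> (e', e) \<in> bd_le B \<longrightarrow> e' = e)"

definition bd_max_path :: "('v, 'e, 'x) ordered_bratteli_diagram_scheme \<Rightarrow> (nat \<Rightarrow> 'e) \<Rightarrow> bool" where
  "bd_max_path B x \<longleftrightarrow> x \<in> bd_paths B \<and> (\<forall>i. bd_max_edge B (x i))"

definition bd_min_path :: "('v, 'e, 'x) ordered_bratteli_diagram_scheme \<Rightarrow> (nat \<Rightarrow> 'e) \<Rightarrow> bool" where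
  "bd_min_path B x \<longleftrightarrow> x \<in> bd_paths B \<and> (\<forall>i. bd_min_edge B (x i))"

definition properly_ordered :: "('v, 'e, 'x) ordered_bratteli_diagram_scheme \<Rightarrow> bool" where
  "properly_ordered B \<longleftrightarrow>
     is_ordered_bratteli_diagram B \<and> bd_simple B \<and>
     (\<exists>!x. bd_max_path B x) \<and> (\<exists>!x. bd_min_path B x)"

definition bd_successor ::
  "('v, 'e, 'x) ordered_bratteli_diagram_scheme \<Rightarrow> 'e \<Rightarrow> 'e \<Rightarrow> bool" where
  "bd_successor B e e' \<longleftrightarrow>
     e' \<in> bd_edges B \<and> bd_rng B e' = bd_rng B e \<and> (e, e') \<in> bd_le B \<and> e' \<noteq> e \<and>
     (\<forall>g\<in>bd_edges B. bd_rng B g = bd_rng B e \<and> (e, g) \<in> bd_le B \<and> g \<noteq> e \<longrightarrow> (e', g) \<in> bd_le B)"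

definition bd_vershik ::
  "('v, 'e, 'x) ordered_bratteli_diagram_scheme \<Rightarrow> (nat \<Rightarrow> 'e) \<Rightarrow> (nat \<Rightarrow> 'e)" where
  "bd_vershik B x =
     (if bd_max_path B x then (THE y. bd_min_path B y)
      else let n = (LEAST n. \<not> bd_max_edge B (x n)) in
        (THE y. y \<in> bd_paths B \<and> (\<forall>i<n. bd_min_edge B (y i)) \<and>
                bd_successor B (x n) (y n) \<and> (\<forall>i>n. y i = x i)))"

text \<open>
  A Bratteli diagram has countably many vertices and edges, so up to isomorphism both can be
  taken to be natural numbers. The infimum of a nonempty set of type \<^typ>\<open>enat\<close> is its minimum.
\<close>

definition bratteli_topological_rank :: "'a topology \<Rightarrow> ('a \<Rightarrow> 'a) \<Rightarrow> enat" where
  "bratteli_topological_rank X f =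
     Inf {bd_rank B | B :: (nat, nat) ordered_bratteli_diagram.
            properly_ordered B \<and>
            topologically_conjugate (bd_path_space B) (bd_vershik B) X f}"


section \<open>Graph coverings of Gambaudo--Martens type\<close>

definition is_cover_graph :: "'v pair_pre_digraph \<Rightarrow> bool" where
  "is_cover_graph G \<longleftrightarrow>
     pair_fin_digraph G \<and>
     (\<forall>v\<in>pverts G. (\<exists>u. (u, v) \<in> parcs G) \<and> (\<exists>w. (v, w) \<in> parcs G))"

definition graph_hom ::
  "'v pair_pre_digraph \<Rightarrow> 'w pair_pre_digraph \<Rightarrow> ('v \<Rightarrow> 'w) \<Rightarrow> bool" where
  "graph_hom G H \<phi> \<longleftrightarrow>
     \<phi> ` pverts G \<subseteq> pverts H \<and> (\<forall>(u, v)\<in>parcs G. (\<phi> u, \<phi> v) \<in> parcs H)"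

definition edge_surjective ::
  "'v pair_pre_digraph \<Rightarrow> 'w pair_pre_digraph \<Rightarrow> ('v \<Rightarrow> 'w) \<Rightarrow> bool" where
  "edge_surjective G H \<phi> \<longleftrightarrow> map_prod \<phi> \<phi> ` parcs G = parcs H"

definition plus_directional :: "'v pair_pre_digraph \<Rightarrow> ('v \<Rightarrow> 'w) \<Rightarrow> bool" where
  "plus_directional G \<phi> \<longleftrightarrow>
     (\<forall>u v v'. (u, v) \<in> parcs G \<and> (u, v') \<in> parcs G \<longrightarrow> \<phi> v = \<phi> v')"

definition is_cover ::
  "'v pair_pre_digraph \<Rightarrow> 'w pair_pre_digraph \<Rightarrow> ('v \<Rightarrow> 'w) \<Rightarrow> bool" where
  "is_cover G H \<phi> \<longleftrightarrow> graph_hom G H \<phi> \<and> edge_surjective G H \<phi> \<and> plus_directional G \<phi>"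

record 'v covering =
  cov_graph :: "nat \<Rightarrow> 'v pair_pre_digraph"
  cov_map :: "nat \<Rightarrow> 'v \<Rightarrow> 'v"

definition is_covering :: "('v, 'x) covering_scheme \<Rightarrow> bool" where
  "is_covering C \<longleftrightarrow>
     (\<forall>n. is_cover_graph (cov_graph C n)) \<and>
     (\<exists>v0. pverts (cov_graph C 0) = {v0} \<and> parcs (cov_graph C 0) = {(v0, v0)}) \<and>
     (\<forall>n. is_cover (cov_graph C (Suc n)) (cov_graph C n) (cov_map C n))"

text \<open>\<open>cov_comp C m n\<close> is the composite \<open>G\<^sub>m \<rightarrow> G\<^sub>n\<close>; it is only meaningful for \<open>m \<ge> n\<close>.\<close>

primrec cov_comp :: "('v, 'x) covering_scheme \<Rightarrow> nat \<Rightarrow> nat \<Rightarrow> 'v \<Rightarrow> 'v" where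
  "cov_comp C 0 n = id"
| "cov_comp C (Suc m) n = (if n \<le> m then cov_comp C m n \<circ> cov_map C m else id)"

definition cov_limit :: "('v, 'x) covering_scheme \<Rightarrow> (nat \<Rightarrow> 'v) set" where
  "cov_limit C =
     {x. \<forall>i. x i \<in> pverts (cov_graph C i) \<and> x i = cov_map C i (x (Suc i))}"

definition cov_limit_space :: "('v, 'x) covering_scheme \<Rightarrow> (nat \<Rightarrow> 'v) topology" where
  "cov_limit_space C =
     subtopology (product_topology (\<lambda>i. discrete_topology (pverts (cov_graph C i))) UNIV)
       (cov_limit C)"

definition cov_limit_map :: "('v, 'x) covering_scheme \<Rightarrow> (nat \<Rightarrow> 'v) \<Rightarrow> (nat \<Rightarrow> 'v)" where
  "cov_limit_map C x = (THE y. y \<in> cov_limit C \<and> (\<forall>i. (x i, y i) \<in> parcs (cov_graph C i)))"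

definition is_circuit :: "'v pair_pre_digraph \<Rightarrow> 'v list \<Rightarrow> bool" where
  "is_circuit G w \<longleftrightarrow>
     vwalk w (with_proj G) \<and> vwalk_length w \<ge> 1 \<and> hd w = last w \<and> distinct (butlast w)"

text \<open>
  \<open>gm_circuit C n i\<close> for \<open>1 \<le> i \<le> gm_num C n\<close> is the circuit \<open>c\<^sub>n\<^sub>,\<^sub>i\<close> as its list of vertices
  \<open>v\<^sub>n\<^sub>,\<^sub>i\<^sub>,\<^sub>0, v\<^sub>n\<^sub>,\<^sub>i\<^sub>,\<^sub>1, \<dots>\<close>. The values of the three fields at \<open>n = 0\<close> carry no meaning.
\<close>

record 'v gm_covering = "'v covering" +
  gm_base :: "nat \<Rightarrow> 'v"
  gm_num :: "nat \<Rightarrow> nat"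
  gm_circuit :: "nat \<Rightarrow> nat \<Rightarrow> 'v list"

text \<open>
  The coinciding vertices in the fourth clause force the two circuits to agree from there on and
  to reach their common end \<open>gm_base C n\<close> after the same number \<open>k\<close> of steps.
\<close>

definition is_gm_level :: "('v, 'x) gm_covering_scheme \<Rightarrow> nat \<Rightarrow> bool" where
  "is_gm_level C n \<longleftrightarrow>
     gm_base C n \<in> pverts (cov_graph C n) \<and>
     inj_on (gm_circuit C n) {1..gm_num C n} \<and>
     (\<forall>i\<in>{1..gm_num C n}.
        is_circuit (cov_graph C n) (gm_circuit C n i) \<and> hd (gm_circuit C n i) = gm_base C n) \<and>
     (\<Union>i\<in>{1..gm_num C n}. set (vwalk_arcs (gm_circuit C n i))) = parcs (cov_graph C n) \<and>
     (\<forall>i\<in>{1..gm_num C n}. \<forall>i'\<in>{1..gm_num C n}.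
        \<forall>j\<in>{1..vwalk_length (gm_circuit C n i)}. \<forall>j'\<in>{1..vwalk_length (gm_circuit C n i')}.
          gm_circuit C n i ! j = gm_circuit C n i' ! j' \<longrightarrow>
          (\<exists>k. j + k = vwalk_length (gm_circuit C n i) \<and>
               j' + k = vwalk_length (gm_circuit C n i') \<and>
               (\<forall>k'\<le>k. gm_circuit C n i ! (j + k') = gm_circuit C n i' ! (j' + k'))))"

definition is_gm_covering :: "('v, 'x) gm_covering_scheme \<Rightarrow> bool" where
  "is_gm_covering C \<longleftrightarrow>
     is_covering C \<and>
     (\<forall>n>0. is_gm_level C n \<and>
        cov_map C n (gm_base C (Suc n)) = gm_base C n \<and>
        (\<forall>i\<in>{1..gm_num C (Suc n)}.
           cov_map C n (gm_circuit C (Suc n) i ! 1) = gm_circuit C n 1 ! 1))"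

definition gm_simple :: "('v, 'x) gm_covering_scheme \<Rightarrow> bool" where
  "gm_simple C \<longleftrightarrow>
     (\<forall>n>0. \<exists>m>n. \<forall>i\<in>{1..gm_num C m}.
        set (vwalk_arcs (map (cov_comp C m n) (gm_circuit C m i))) = parcs (cov_graph C n))"

definition gm_rank :: "('v, 'x) gm_covering_scheme \<Rightarrow> enat" where
  "gm_rank C = liminf (\<lambda>n. enat (gm_num C n))"

text \<open>The graphs are finite, so up to isomorphism their vertices are natural numbers.\<close>

definition gm_topological_rank :: "'a topology \<Rightarrow> ('a \<Rightarrow> 'a) \<Rightarrow> enat" where
  "gm_topological_rank X f =
     Inf {gm_rank C | C :: nat gm_covering.
            is_gm_covering C \<and> gm_simple C \<and>
            topologically_conjugate (cov_limit_space C) (cov_limit_map C) X f}"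

end

theory Submission
  imports Defs
begin

text \<open>
  Both kinds of data describe nested sequences of Kakutani--Rokhlin partitions. In an ordered
  Bratteli diagram a vertex \<open>v\<close> of level \<open>n\<close> is a tower whose floors are the paths from the top
  vertex to \<open>v\<close>, in the order in which the Vershik map runs through them. In a covering of
  Gambaudo--Martens type a circuit of level \<open>n\<close> is a tower with one floor for each of its steps,
  and the ground floors of all towers are merged into the base vertex. In both cases the rank
  counts the towers per level.

  The two systems are compared by sending an infinite path \<open>x\<close> to the sequence whose \<open>n\<close>-th entry
  is the vertex that the circuit of the tower of \<open>x\<close> reaches after \<open>pos x n\<close> steps, where
  \<open>pos x n\<close> is the floor of \<open>x\<close> at level \<open>n\<close>. This is continuous, by compactness it hits every
  point of the inverse limit, and since the Vershik map climbs the towers (\<open>vershik_floor\<close>) it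
  turns that map into the limit map. So it is a conjugacy as soon as it is injective
  (\<open>vershik_conjugate_cov_limit\<close>).

  From a covering to a diagram (\<open>bratteli_of_gm_covering\<close>): the image of a circuit of level
  \<open>n + 1\<close> is a closed walk through the base vertex, and as walks branch only at the base vertex
  it splits uniquely into circuits of level \<open>n\<close> (\<open>proj_follows\<close>). These factors, in their order,
  are the edges of the diagram. All these walks start with the same circuit, so there is one
  minimal path; the maximal paths code the preimages of the point all of whose coordinates are
  base vertices, so there is one of them because \<open>f\<close> is bijective. Injectivity of \<open>f\<close> also
  makes the coding injective: one reads off the floor of \<open>x\<close> by following the orbit backwards
  to the base vertex (\<open>point_determines_floor\<close>).

  From a diagram to a covering (\<open>gm_covering_of_bratteli\<close>): merging the ground floors of a level
  yields a covering if all paths on the ground floors of one chosen level lie in a single tower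
  of the chosen level before. Such levels exist since the ground floors shrink to the unique
  minimal path, and if the rank is a finite number \<open>k\<close>, they can be chosen among the infinitely
  many levels with at most \<open>k\<close> vertices. The merging loses no information in the limit,
  because a path that is on the ground floor at every level is the minimal one.
\<close>


section \<open>Spaces of sequences over finite alphabets\<close>

definition sequence_space :: "(nat \<Rightarrow> 'a set) \<Rightarrow> (nat \<Rightarrow> 'a) topology" where
  "sequence_space A = product_topology (\<lambda>i. discrete_topology (A i)) UNIV"

lemma topspace_sequence_space [simp]: "topspace (sequence_space A) = {x. \<forall>i. x i \<in> A i}"
  by (auto simp: sequence_space_def PiE_def)

lemma Hausdorff_sequence_space: "Hausdorff_space (sequence_space A)"
  unfolding sequence_space_def
  by (simp add: Hausdorff_space_product_topology Hausdorff_space_discrete_topology)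

lemma compact_sequence_space: "(\<And>i. finite (A i)) \<Longrightarrow> compact_space (sequence_space A)"
  unfolding sequence_space_def
  by (simp add: compact_space_product_topology compact_space_discrete_topology)

text \<open>
  All topological arguments below reduce to this: what is decided by finitely many
  coordinates varies continuously.
\<close>

lemma openin_finitely_determined:
  assumes "\<And>x y. \<forall>i<n. x i = y i \<Longrightarrow> P x \<longleftrightarrow> P y"
  shows "openin (sequence_space A) {x. (\<forall>i. x i \<in> A i) \<and> P x}"
proof (subst openin_subopen, intro ballI)
  fix x assume "x \<in> {x. (\<forall>i. x i \<in> A i) \<and> P x}"
  then have xA: "\<And>i. x i \<in> A i" and Px: "P x"
    by auto
  let ?C = "Pi\<^sub>E UNIV (\<lambda>i. if i < n then {x i} else A i)"
  have "openin (sequence_space A) ?C"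
    unfolding sequence_space_def openin_PiE_gen
    using xA by (auto intro!: disjI2 finite_subset[of _ "{..<n}"] split: if_splits)
  moreover have "?C \<subseteq> {x. (\<forall>i. x i \<in> A i) \<and> P x}"
  proof
    fix y assume "y \<in> ?C"
    then have y: "y i \<in> (if i < n then {x i} else A i)" for i
      by (auto simp: PiE_def Pi_def)
    have "\<forall>i<n. x i = y i"
      using y by (metis singletonD)
    moreover have "y i \<in> A i" for i
      using y[of i] xA[of i] by (auto split: if_splits)
    ultimately show "y \<in> {x. (\<forall>i. x i \<in> A i) \<and> P x}"
      using assms Px by blast
  qed
  moreover have "x \<in> ?C"
    using xA by auto
  ultimately show "\<exists>T. openin (sequence_space A) T \<and> x \<in> T \<and> T \<subseteq> {x. (\<forall>i. x i \<in> A i) \<and> P x}"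
    by blast
qed

lemma closedin_finitely_determined:
  assumes "\<And>x y. \<forall>i<n. x i = y i \<Longrightarrow> P x \<longleftrightarrow> P y"
  shows "closedin (sequence_space A) {x. (\<forall>i. x i \<in> A i) \<and> P x}"
proof -
  have "openin (sequence_space A) {x. (\<forall>i. x i \<in> A i) \<and> \<not> P x}"
    by (rule openin_finitely_determined) (use assms in blast)
  moreover have "topspace (sequence_space A) - {x. (\<forall>i. x i \<in> A i) \<and> P x}
      = {x. (\<forall>i. x i \<in> A i) \<and> \<not> P x}"
    by auto
  ultimately show ?thesis
    by (simp add: closedin_def) blast
qed


section \<open>Topological conjugacy\<close>

lemma topologically_conjugate_trans:
  assumes "topologically_conjugate X f Y g" "topologically_conjugate Y g Z k"
  shows "topologically_conjugate X f Z k"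
proof -
  obtain u where u: "homeomorphic_map X Y u" "\<forall>x\<in>topspace X. u (f x) = g (u x)"
    using assms(1) by (auto simp: topologically_conjugate_def)
  obtain v where v: "homeomorphic_map Y Z v" "\<forall>y\<in>topspace Y. v (g y) = k (v y)"
    using assms(2) by (auto simp: topologically_conjugate_def)
  have "u x \<in> topspace Y" if "x \<in> topspace X" for x
    using u(1) that by (metis homeomorphic_imp_surjective_map imageI)
  then have "\<forall>x\<in>topspace X. (v \<circ> u) (f x) = k ((v \<circ> u) x)"
    using u(2) v(2) by simp
  then show ?thesis
    using u(1) v(1) homeomorphic_map_compose unfolding topologically_conjugate_def by blast
qed

lemma topologically_conjugate_sym:
  assumes "topologically_conjugate X f Y g" and f: "f ` topspace X \<subseteq> topspace X"
  shows "topologically_conjugate Y g X f"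
proof -
  obtain u where u: "homeomorphic_map X Y u" "\<forall>x\<in>topspace X. u (f x) = g (u x)"
    using assms(1) by (auto simp: topologically_conjugate_def)
  then obtain v where uv: "homeomorphic_maps X Y u v"
    by (auto simp: homeomorphic_map_maps)
  then have v: "homeomorphic_map Y X v"
    using homeomorphic_maps_map by blast
  have vu: "v (u x) = x" if "x \<in> topspace X" for x
    using uv that by (simp add: homeomorphic_maps_def)
  have "v (g y) = f (v y)" if y: "y \<in> topspace Y" for y
  proof -
    have vy: "v y \<in> topspace X" and "u (v y) = y"
      using uv y v by (auto simp: homeomorphic_maps_def dest: homeomorphic_imp_surjective_map)
    then have "g y = u (f (v y))"
      using u(2) by simp
    moreover have "f (v y) \<in> topspace X"
      using f vy by auto
    ultimately show ?thesis
      using vu by simp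
  qed
  then show ?thesis
    using v unfolding topologically_conjugate_def by blast
qed


section \<open>Towers of an ordered Bratteli diagram\<close>

locale ordered_bratteli =
  fixes B :: "('v, 'e, 'x) ordered_bratteli_diagram_scheme"
  assumes ordered: "is_ordered_bratteli_diagram B"
begin

abbreviation "V \<equiv> bd_V B"
abbreviation "E \<equiv> bd_E B"
abbreviation "src \<equiv> bd_src B"
abbreviation "rng \<equiv> bd_rng B"
abbreviation "paths \<equiv> bd_paths B"

definition into :: "nat \<Rightarrow> 'v \<Rightarrow> 'e set" where
  "into n v = {e \<in> E n. rng e = v}"

definition below :: "nat \<Rightarrow> 'e \<Rightarrow> 'e set" where
  "below n e = {e' \<in> into n (rng e). (e', e) \<in> bd_le B \<and> e' \<noteq> e}"

text \<open>The number of paths from the top vertex to \<open>v\<close>, that is, the height of the tower of \<open>v\<close>.\<close>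

primrec height :: "nat \<Rightarrow> 'v \<Rightarrow> nat" where
  "height 0 v = 1"
| "height (Suc n) v = (\<Sum>e\<in>into n v. height n (src e))"

text \<open>
  The tower of a vertex is a stack of copies of the towers of the sources of its incoming edges.
  The copy for \<open>e\<close> begins at floor \<open>offset n e\<close>.
\<close>

definition offset :: "nat \<Rightarrow> 'e \<Rightarrow> nat" where
  "offset n e = (\<Sum>e'\<in>below n e. height n (src e'))"

text \<open>
  \<open>pos x n\<close> is the floor on which \<open>x\<close> lies in its tower of level \<open>n\<close>: the number of paths
  with the same end that precede the first \<open>n\<close> edges of \<open>x\<close> in the order in which the
  Vershik map runs through them.
\<close>

primrec pos :: "(nat \<Rightarrow> 'e) \<Rightarrow> nat \<Rightarrow> nat" where
  "pos x 0 = 0"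
| "pos x (Suc n) = offset n (x n) + pos x n"

lemma bratteli: "is_bratteli_diagram B"
  using ordered by (simp add: is_ordered_bratteli_diagram_def)

lemma finite_V [simp]: "finite (V n)"
  and finite_E [simp]: "finite (E n)"
  using bratteli by (auto simp: is_bratteli_diagram_def)

lemma src_in: "e \<in> E n \<Longrightarrow> src e \<in> V n" and rng_in: "e \<in> E n \<Longrightarrow> rng e \<in> V (Suc n)"
  using bratteli by (auto simp: is_bratteli_diagram_def)

lemma E_edges: "e \<in> E n \<Longrightarrow> e \<in> bd_edges B"
  by (auto simp: bd_edges_def)

lemma V_level: "v \<in> V m \<Longrightarrow> v \<in> V n \<Longrightarrow> m = n"
  using bratteli by (auto simp: is_bratteli_diagram_def disjoint_family_on_def)

lemma edge_level_rng: "e \<in> bd_edges B \<Longrightarrow> rng e \<in> V (Suc n) \<Longrightarrow> e \<in> E n"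
  unfolding bd_edges_def using V_level rng_in by (metis UN_E nat.inject)

lemma edge_level_src: "e \<in> bd_edges B \<Longrightarrow> src e \<in> V n \<Longrightarrow> e \<in> E n"
  unfolding bd_edges_def using V_level src_in by (metis UN_E)

lemma edge_from: "v \<in> V n \<Longrightarrow> \<exists>e\<in>E n. src e = v"
  using bratteli edge_level_src unfolding is_bratteli_diagram_def by metis

lemma edge_into: "v \<in> V (Suc n) \<Longrightarrow> \<exists>e\<in>E n. rng e = v"
  using bratteli edge_level_rng unfolding is_bratteli_diagram_def by metis

lemma edge_le_total:
  "e \<in> E n \<Longrightarrow> e' \<in> E n \<Longrightarrow> rng e = rng e' \<Longrightarrow> (e, e') \<in> bd_le B \<or> (e', e) \<in> bd_le B"
  using ordered E_edges unfolding is_ordered_bratteli_diagram_def by metis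

lemma edge_le_refl: "e \<in> E n \<Longrightarrow> (e, e) \<in> bd_le B"
  using edge_le_total by blast

lemma edge_le_antisym: "(e, e') \<in> bd_le B \<Longrightarrow> (e', e) \<in> bd_le B \<Longrightarrow> e = e'"
  using ordered unfolding is_ordered_bratteli_diagram_def partial_order_on_def
  by (auto dest: antisymD)

lemma edge_le_trans: "(a, b) \<in> bd_le B \<Longrightarrow> (b, c) \<in> bd_le B \<Longrightarrow> (a, c) \<in> bd_le B"
  using ordered unfolding is_ordered_bratteli_diagram_def partial_order_on_def preorder_on_def
  by (auto dest: transD)

lemma finite_into [simp]: "finite (into n v)" and finite_below [simp]: "finite (below n e)"
  by (auto simp: into_def below_def)

lemma path_edge: "x \<in> paths \<Longrightarrow> x i \<in> E i" and path_rng: "x \<in> paths \<Longrightarrow> rng (x i) = src (x (Suc i))"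
  by (auto simp: bd_paths_def)

lemma path_into: "x \<in> paths \<Longrightarrow> x n \<in> into n (src (x (Suc n)))"
  by (simp add: into_def path_edge path_rng)

lemma path_vertex: "x \<in> paths \<Longrightarrow> src (x n) \<in> V n"
  using path_edge src_in by blast

lemma height_pos: "v \<in> V n \<Longrightarrow> height n v > 0"
proof (induction n arbitrary: v)
  case (Suc n)
  obtain e where e: "e \<in> into n v"
    using edge_into[OF Suc.prems] by (auto simp: into_def)
  then have "height n (src e) > 0"
    using Suc.IH src_in by (auto simp: into_def)
  moreover have "height n (src e) \<le> height (Suc n) v"
    unfolding height.simps using e by (intro member_le_sum) auto
  ultimately show ?case
    by linarith
qed simp

subsection \<open>The towers stacked over one vertex\<close>

lemma offset_upto:
  assumes "e \<in> E n"
  shows "offset n e + height n (src e) = (\<Sum>e'\<in>insert e (below n e). height n (src e'))"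
  using assms by (simp add: offset_def below_def)

lemma offset_le_height:
  assumes "e \<in> into n v"
  shows "offset n e + height n (src e) \<le> height (Suc n) v"
proof -
  have "insert e (below n e) \<subseteq> into n v"
    using assms by (auto simp: below_def into_def)
  then have "(\<Sum>e'\<in>insert e (below n e). height n (src e')) \<le> height (Suc n) v"
    unfolding height.simps by (intro sum_mono2) auto
  then show ?thesis
    using assms by (simp add: offset_upto into_def del: sum.insert)
qed

lemma offset_less:
  assumes "e \<in> into n v" "e' \<in> into n v" "(e, e') \<in> bd_le B" "e \<noteq> e'"
  shows "offset n e + height n (src e) \<le> offset n e'"
proof -
  have "insert e (below n e) \<subseteq> below n e'"
    using assms edge_le_trans edge_le_antisym by (auto simp: below_def into_def)
  then have "(\<Sum>e'\<in>insert e (below n e). height n (src e')) \<le> offset n e'"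
    unfolding offset_def by (intro sum_mono2) auto
  then show ?thesis
    using assms by (simp add: offset_upto into_def del: sum.insert)
qed

lemma offset_interval_unique:
  assumes "e \<in> into n v" "e' \<in> into n v"
    and "offset n e \<le> j" "j < offset n e + height n (src e)"
    and "offset n e' \<le> j" "j < offset n e' + height n (src e')"
  shows "e = e'"
proof (rule ccontr)
  assume "e \<noteq> e'"
  moreover have "(e, e') \<in> bd_le B \<or> (e', e) \<in> bd_le B"
    using assms(1,2) edge_le_total by (auto simp: into_def)
  ultimately show False
    using offset_less[of e n v e'] offset_less[of e' n v e] assms by force
qed

text \<open>
  The intervals that the edges into \<open>v\<close> occupy are disjoint and have total length
  \<open>height (Suc n) v\<close>, so they leave no gap.
\<close>

lemma offset_interval_exists:
  assumes "j < height (Suc n) v"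
  shows "\<exists>e\<in>into n v. offset n e \<le> j \<and> j < offset n e + height n (src e)"
proof -
  let ?I = "\<lambda>e. {offset n e ..< offset n e + height n (src e)}"
  have "card (\<Union>e\<in>into n v. ?I e) = (\<Sum>e\<in>into n v. card (?I e))"
  proof (rule card_UN_disjoint)
    show "\<forall>e\<in>into n v. \<forall>e'\<in>into n v. e \<noteq> e' \<longrightarrow> ?I e \<inter> ?I e' = {}"
    proof (intro ballI impI)
      fix e e' assume "e \<in> into n v" "e' \<in> into n v" "e \<noteq> e'"
      then show "?I e \<inter> ?I e' = {}"
        using offset_interval_unique[of e n v e'] by (meson atLeastLessThan_iff disjoint_iff)
    qed
  qed auto
  then have "card (\<Union>e\<in>into n v. ?I e) = height (Suc n) v"
    by simp
  moreover have "(\<Union>e\<in>into n v. ?I e) \<subseteq> {..<height (Suc n) v}"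
    using offset_le_height by force
  ultimately have "(\<Union>e\<in>into n v. ?I e) = {..<height (Suc n) v}"
    by (intro card_subset_eq) auto
  then have "j \<in> (\<Union>e\<in>into n v. ?I e)"
    using assms by blast
  then show ?thesis
    by (meson UN_E atLeastLessThan_iff)
qed

lemma min_edge_iff:
  assumes "e \<in> E n"
  shows "bd_min_edge B e \<longleftrightarrow> offset n e = 0"
proof -
  have "bd_min_edge B e \<longleftrightarrow> below n e = {}"
  proof -
    have "e' \<in> bd_edges B \<and> rng e' = rng e \<longleftrightarrow> e' \<in> into n (rng e)" for e'
      using assms edge_level_rng[of e' n] rng_in[of e n] E_edges by (auto simp: into_def)
    then show ?thesis
      unfolding bd_min_edge_def below_def by blast
  qed
  also have "\<dots> \<longleftrightarrow> offset n e = 0"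
    using height_pos src_in by (fastforce simp: offset_def below_def into_def)
  finally show ?thesis .
qed

lemma max_edge_iff:
  assumes "e \<in> into n v"
  shows "bd_max_edge B e \<longleftrightarrow> offset n e + height n (src e) = height (Suc n) v"
proof
  assume max: "bd_max_edge B e"
  have "e' \<in> insert e (below n e)" if "e' \<in> into n v" for e'
  proof -
    have "e' \<in> E n" "rng e' = rng e" "e \<in> E n"
      using that assms by (auto simp: into_def)
    then show ?thesis
      using max E_edges[of e' n] edge_le_total[of e n e'] by (auto simp: bd_max_edge_def below_def into_def)
  qed
  then have "insert e (below n e) = into n v"
    using assms by (auto simp: below_def into_def)
  then show "offset n e + height n (src e) = height (Suc n) v"
    using assms by (simp add: offset_upto into_def del: sum.insert)
next
  assume top: "offset n e + height n (src e) = height (Suc n) v"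
  have "e' = e" if e': "e' \<in> bd_edges B" "rng e' = rng e" "(e, e') \<in> bd_le B" for e'
  proof (rule ccontr)
    assume "e' \<noteq> e"
    have "e' \<in> into n v"
      using e' assms edge_level_rng rng_in by (metis (mono_tags, lifting) into_def mem_Collect_eq)
    moreover from this have "height n (src e') > 0"
      using height_pos src_in by (auto simp: into_def)
    ultimately show False
      using offset_less[OF assms, of e'] offset_le_height[of e' n v] e' \<open>e' \<noteq> e\<close> top by force
  qed
  then show "bd_max_edge B e"
    by (auto simp: bd_max_edge_def)
qed

subsection \<open>Floors of paths\<close>

lemma pos_less: "x \<in> paths \<Longrightarrow> pos x n < height n (src (x n))"
proof (induction n)
  case (Suc n)
  then show ?case
    using offset_le_height[OF path_into[OF Suc.prems], of n] by simp
qed simp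

lemma pos_cong: "\<forall>i<n. x i = y i \<Longrightarrow> pos x n = pos y n"
  by (induction n) auto

text \<open>
  The copies in the stack of a tower occupy disjoint intervals of floors, so the floor of a path
  reveals its last edge, and by recursion the earlier ones.
\<close>

lemma pos_inject:
  assumes "x \<in> paths" "y \<in> paths" "src (x n) = src (y n)" "pos x n = pos y n" "i < n"
  shows "x i = y i"
  using assms(3-)
proof (induction n)
  case (Suc n)
  have "x n = y n"
  proof (rule offset_interval_unique)
    show "x n \<in> into n (src (x (Suc n)))" "y n \<in> into n (src (x (Suc n)))"
      using path_into[OF assms(1), of n] path_into[OF assms(2), of n] Suc.prems(1) by auto
    show "offset n (x n) \<le> pos x (Suc n)" "pos x (Suc n) < offset n (x n) + height n (src (x n))"
      using pos_less[OF assms(1)] by simp_all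
    show "offset n (y n) \<le> pos x (Suc n)" "pos x (Suc n) < offset n (y n) + height n (src (y n))"
      using pos_less[OF assms(2)] Suc.prems(2) by simp_all
  qed
  then show ?case
    using Suc by (cases "i = n") auto
qed simp

lemma pos_determines_lower:
  assumes "x \<in> paths" "y \<in> paths" "src (x n) = src (y n)" "pos x n = pos y n" "m \<le> n"
  shows "src (x m) = src (y m)" "pos x m = pos y m"
proof -
  have eq: "\<forall>i<n. x i = y i"
    using pos_inject[OF assms(1-4)] by blast
  then show "pos x m = pos y m"
    using assms(5) by (intro pos_cong) auto
  show "src (x m) = src (y m)"
    using eq assms(3,5) by (cases "m = n") auto
qed

lemma pos_zero_iff: "x \<in> paths \<Longrightarrow> pos x n = 0 \<longleftrightarrow> (\<forall>i<n. bd_min_edge B (x i))"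
  by (induction n) (auto simp: less_Suc_eq min_edge_iff[OF path_edge])

lemma pos_top_iff:
  assumes "x \<in> paths"
  shows "Suc (pos x n) = height n (src (x n)) \<longleftrightarrow> (\<forall>i<n. bd_max_edge B (x i))"
proof (induction n)
  case (Suc n)
  have "offset n (x n) + height n (src (x n)) \<le> height (Suc n) (src (x (Suc n)))"
    "pos x n < height n (src (x n))"
    using offset_le_height[OF path_into] pos_less assms by auto
  then have "Suc (pos x (Suc n)) = height (Suc n) (src (x (Suc n))) \<longleftrightarrow>
    Suc (pos x n) = height n (src (x n)) \<and>
    offset n (x n) + height n (src (x n)) = height (Suc n) (src (x (Suc n)))"
    unfolding pos.simps by linarith
  then show ?case
    using Suc.IH max_edge_iff[OF path_into[OF assms], of n] by (auto simp: less_Suc_eq)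
qed simp

definition tail_from :: "nat \<Rightarrow> (nat \<Rightarrow> 'e) \<Rightarrow> bool" where
  "tail_from n y \<longleftrightarrow> (\<forall>i\<ge>n. y i \<in> E i \<and> rng (y i) = src (y (Suc i)))"

lemma path_tail: "x \<in> paths \<Longrightarrow> tail_from n x"
  by (simp add: tail_from_def bd_paths_def)

lemma tail_exists: "v \<in> V n \<Longrightarrow> \<exists>y. tail_from n y \<and> src (y n) = v"
proof -
  assume v: "v \<in> V n"
  have "\<exists>f. \<forall>k. (f k \<in> E (n + k) \<and> (k = 0 \<longrightarrow> src (f k) = v)) \<and> src (f (Suc k)) = rng (f k)"
  proof (rule dependent_nat_choice)
    show "\<exists>e. e \<in> E (n + 0) \<and> ((0::nat) = 0 \<longrightarrow> src e = v)"
      using edge_from[OF v] by auto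
    show "\<exists>e'. (e' \<in> E (n + Suc k) \<and> (Suc k = 0 \<longrightarrow> src e' = v)) \<and> src e' = rng e"
      if "e \<in> E (n + k) \<and> (k = 0 \<longrightarrow> src e = v)" for e k
      using edge_from[of "rng e" "Suc (n + k)"] rng_in that by auto
  qed
  then obtain f where f: "\<And>k. f k \<in> E (n + k)" "src (f 0) = v" "\<And>k. src (f (Suc k)) = rng (f k)"
    by blast
  have "tail_from n (\<lambda>i. f (i - n))"
    unfolding tail_from_def using f(1,3) by (auto simp: Suc_diff_le) (metis le_add_diff_inverse)
  then show ?thesis
    using f(2) by auto
qed

text \<open>
  Any floor of a tower can be reached without changing a path from level \<open>n\<close> on. This supplies
  the images of paths under the Vershik map as well as their preimages.
\<close>

lemma floor_above_tail:
  assumes "tail_from n y" "j < height n (src (y n))"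
  shows "\<exists>x\<in>paths. (\<forall>i\<ge>n. x i = y i) \<and> pos x n = j"
  using assms
proof (induction n arbitrary: y j)
  case 0
  then have "y \<in> paths"
    by (auto simp: tail_from_def bd_paths_def)
  then show ?case
    using 0 by auto
next
  case (Suc n)
  let ?v = "src (y (Suc n))"
  obtain e where e: "e \<in> into n ?v" "offset n e \<le> j" "j < offset n e + height n (src e)"
    using offset_interval_exists Suc.prems(2) by blast
  have "tail_from n (y(n := e))"
    using Suc.prems(1) e(1) by (auto simp: tail_from_def into_def)
  moreover have "j - offset n e < height n (src ((y(n := e)) n))"
    using e by auto
  ultimately obtain x where x: "x \<in> paths" "\<forall>i\<ge>n. x i = (y(n := e)) i" "pos x n = j - offset n e"
    using Suc.IH by blast
  have "pos x (Suc n) = j"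
    using x(2,3) e(2) by simp
  then show ?case
    using x(1,2) by (intro bexI[of _ x]) auto
qed

lemma floor_exists:
  assumes "v \<in> V n" "j < height n v"
  shows "\<exists>x\<in>paths. src (x n) = v \<and> pos x n = j"
proof -
  obtain y where y: "tail_from n y" "src (y n) = v"
    using tail_exists[OF assms(1)] by blast
  then obtain x where x: "x \<in> paths" "\<forall>i\<ge>n. x i = y i" "pos x n = j"
    using floor_above_tail assms(2) by blast
  then have "src (x n) = v"
    using y(2) by simp
  then show ?thesis
    using x(1,3) by blast
qed

lemma splice_paths:
  assumes "x \<in> paths" "y \<in> paths" "src (x n) = src (y n)"
  shows "(\<lambda>i. if i < n then x i else y i) \<in> paths"
    (is "?z \<in> paths")
proof -
  have "?z i \<in> E i \<and> rng (?z i) = src (?z (Suc i))" for i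
  proof (cases "Suc i = n")
    case True
    then show ?thesis
      using path_edge[OF assms(1), of i] path_rng[OF assms(1), of i] assms(3) by auto
  next
    case False
    then show ?thesis
      using path_edge[OF assms(1), of i] path_rng[OF assms(1), of i]
        path_edge[OF assms(2), of i] path_rng[OF assms(2), of i] by auto
  qed
  then show ?thesis
    by (simp add: bd_paths_def)
qed

subsection \<open>Compactness of the path space\<close>

lemma bd_path_space_subtopology: "bd_path_space B = subtopology (sequence_space E) paths"
  by (simp add: bd_path_space_def sequence_space_def)

lemma topspace_bd_path_space [simp]: "topspace (bd_path_space B) = paths"
  by (auto simp: bd_path_space_subtopology path_edge)

lemma closedin_paths: "closedin (sequence_space E) paths"
proof -
  have "closedin (sequence_space E)
      (\<Inter>i. {x. (\<forall>k. x k \<in> E k) \<and> rng (x i) = src (x (Suc i))})"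
  proof (rule closedin_INT)
    fix i
    show "closedin (sequence_space E) {x. (\<forall>k. x k \<in> E k) \<and> rng (x i) = src (x (Suc i))}"
      by (rule closedin_finitely_determined[where n = "Suc (Suc i)"]) simp
  qed simp
  moreover have "(\<Inter>i. {x. (\<forall>k. x k \<in> E k) \<and> rng (x i) = src (x (Suc i))}) = paths"
    by (auto simp: bd_paths_def)
  ultimately show ?thesis
    by simp
qed

lemma compact_bd_path_space: "compact_space (bd_path_space B)"
  unfolding bd_path_space_subtopology
  by (intro compact_space_subtopology closedin_compact_space compact_sequence_space closedin_paths)
    simp

text \<open>
  Koenig's lemma, obtained from compactness.
\<close>

lemma nested_conditions_on_paths:
  assumes determined: "\<And>n x y. \<forall>i<m n. x i = y i \<Longrightarrow> P n x \<longleftrightarrow> P n y"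
    and decreasing: "\<And>n x. x \<in> paths \<Longrightarrow> P (Suc n) x \<Longrightarrow> P n x"
    and nonempty: "\<And>n. \<exists>x\<in>paths. P n x"
  shows "\<exists>x\<in>paths. \<forall>n. P n x"
proof -
  let ?C = "\<lambda>n. {x \<in> paths. P n x}"
  have "\<Inter> (range ?C) \<noteq> {}"
  proof (rule compact_space_imp_nest[OF compact_bd_path_space])
    fix n
    have "closedin (sequence_space E) {x. (\<forall>i. x i \<in> E i) \<and> P n x}"
      by (rule closedin_finitely_determined) (rule determined)
    moreover have "?C n = {x. (\<forall>i. x i \<in> E i) \<and> P n x} \<inter> paths"
      by (auto simp: path_edge)
    ultimately show "closedin (bd_path_space B) (?C n)"
      by (auto simp: bd_path_space_subtopology closedin_subtopology)
    show "?C n \<noteq> {}"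
      using nonempty by blast
  next
    show "decseq ?C"
      using decreasing by (intro decseq_SucI) auto
  qed
  then show ?thesis
    by auto
qed

subsection \<open>Connections between levels\<close>

definition connected_levels :: "nat \<Rightarrow> nat \<Rightarrow> bool" where
  "connected_levels m n \<longleftrightarrow>
     (\<forall>u\<in>V m. \<forall>v\<in>V n. \<exists>x\<in>paths. src (x m) = u \<and> src (x n) = v)"

lemma path_through: "v \<in> V n \<Longrightarrow> \<exists>x\<in>paths. src (x n) = v"
  using floor_exists height_pos by blast

lemma connected_levels_mono:
  assumes "connected_levels m n" "m' \<le> m" "m \<le> n" "n \<le> n'"
  shows "connected_levels m' n'"
  unfolding connected_levels_def
proof (intro ballI)
  fix u v assume "u \<in> V m'" "v \<in> V n'"
  then obtain x y where x: "x \<in> paths" "src (x m') = u" and y: "y \<in> paths" "src (y n') = v"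
    using path_through by metis
  obtain z where z: "z \<in> paths" "src (z m) = src (x m)" "src (z n) = src (y n)"
    using assms(1) path_vertex x(1) y(1) unfolding connected_levels_def by blast
  let ?a = "\<lambda>i. if i < m then x i else z i"
  let ?b = "\<lambda>i. if i < n then ?a i else y i"
  have a: "?a \<in> paths"
    using splice_paths[of x z m] x z by simp
  have b: "?b \<in> paths"
    using splice_paths[OF a y(1), of n] z(3) assms(3) by simp
  moreover have "src (?b m') = u" "src (?b n') = v"
    using x y z assms(2-4) by (cases "m' = m"; cases "m = n"; simp)+
  ultimately show "\<exists>x\<in>paths. src (x m') = u \<and> src (x n') = v"
    by (metis (no_types, lifting))
qed

text \<open>
  Since every finite path extends to an infinite one, the connections between two levels can be
  read off from the infinite paths.
\<close>

lemma fully_connected_telescope_iff: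
  assumes "strict_mono t"
  shows "bd_fully_connected (bd_telescope t B) \<longleftrightarrow> (\<forall>k. connected_levels (t k) (t (Suc k)))"
proof -
  have "(\<exists>p\<in>bd_finite_paths B m n. src (hd p) = u \<and> rng (last p) = v) \<longleftrightarrow>
        (\<exists>x\<in>paths. src (x m) = u \<and> src (x n) = v)"
    if "m < n" "u \<in> V m" "v \<in> V n" for m n u v
  proof
    assume "\<exists>p\<in>bd_finite_paths B m n. src (hd p) = u \<and> rng (last p) = v"
    then obtain p where len: "length p = n - m" and p: "\<And>i. i < n - m \<Longrightarrow> p ! i \<in> E (m + i)"
      and pp: "\<And>i. Suc i < n - m \<Longrightarrow> rng (p ! i) = src (p ! Suc i)"
      and ends: "src (hd p) = u" "rng (last p) = v"
      by (auto simp: bd_finite_paths_def)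
    have p0: "src (p ! 0) = u" and pl: "rng (p ! (n - m - 1)) = v"
      using ends len \<open>m < n\<close> by (auto simp: hd_conv_nth last_conv_nth length_greater_0_conv[symmetric]
          simp del: length_greater_0_conv)
    obtain x y where x: "x \<in> paths" "src (x m) = u" and y: "y \<in> paths" "src (y n) = v"
      using path_through \<open>u \<in> V m\<close> \<open>v \<in> V n\<close> by metis
    let ?z = "\<lambda>i. if i < m then x i else if i < n then p ! (i - m) else y i"
    have "?z i \<in> E i \<and> rng (?z i) = src (?z (Suc i))" for i
    proof -
      consider "Suc i < m" | "Suc i = m" | "m \<le> i" "Suc i < n" | "m \<le> i" "Suc i = n" | "n \<le> i"
        by linarith
      then show ?thesis
      proof cases
        case 1
        then show ?thesis
          using path_edge[OF x(1), of i] path_rng[OF x(1), of i] by simp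
      next
        case 2
        then show ?thesis
          using path_edge[OF x(1), of i] path_rng[OF x(1), of i] x(2) p0 \<open>m < n\<close> by auto
      next
        case 3
        then show ?thesis
          using p[of "i - m"] pp[of "i - m"] by (auto simp: Suc_diff_le)
      next
        case 4
        then show ?thesis
          using p[of "i - m"] pl y(2) by auto
      next
        case 5
        then show ?thesis
          using path_edge[OF y(1), of i] path_rng[OF y(1), of i] \<open>m < n\<close> by simp
      qed
    qed
    then have "?z \<in> paths"
      by (simp add: bd_paths_def)
    moreover have "src (?z m) = u" "src (?z n) = v"
      using p0 y(2) \<open>m < n\<close> by auto
    ultimately show "\<exists>x\<in>paths. src (x m) = u \<and> src (x n) = v"
      by (intro bexI[of _ ?z] conjI)
  next
    assume "\<exists>x\<in>paths. src (x m) = u \<and> src (x n) = v"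
    then obtain x where x: "x \<in> paths" "src (x m) = u" "src (x n) = v"
      by blast
    have "map x [m..<n] \<in> bd_finite_paths B m n"
      using path_edge[OF x(1)] path_rng[OF x(1)] by (auto simp: bd_finite_paths_def)
    moreover have "hd (map x [m..<n]) = x m" "last (map x [m..<n]) = x (n - 1)"
      using \<open>m < n\<close> by (auto simp: hd_map last_map)
    moreover have "rng (x (n - 1)) = v"
      using path_rng[OF x(1), of "n - 1"] x(3) \<open>m < n\<close> by simp
    ultimately show "\<exists>p\<in>bd_finite_paths B m n. src (hd p) = u \<and> rng (last p) = v"
      using x(2) by (intro bexI[of _ "map x [m..<n]"]) simp_all
  qed
  moreover have "t k < t (Suc k)" for k
    using assms by (simp add: strict_mono_def)
  ultimately show ?thesis
    by (simp add: bd_fully_connected_def bd_telescope_def connected_levels_def)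
qed

lemma bd_simple_iff:
  "bd_simple B \<longleftrightarrow>
     (\<exists>t. strict_mono t \<and> t 0 = 0 \<and> (\<forall>k. connected_levels (t k) (t (Suc k))))"
  unfolding bd_simple_def using fully_connected_telescope_iff by blast

lemma simple_eventually_connected:
  assumes "bd_simple B"
  shows "\<exists>M>m. \<forall>n\<ge>M. connected_levels m n"
proof -
  obtain t where t: "strict_mono t" "\<And>k. connected_levels (t k) (t (Suc k))"
    using assms bd_simple_iff by blast
  have "m \<le> t m"
    using t(1) strict_mono_imp_increasing by blast
  moreover have "t m < t (Suc m)"
    using t(1) by (simp add: strict_mono_def)
  ultimately show ?thesis
    using connected_levels_mono[OF t(2)[of m]] by (intro exI[of _ "t (Suc m)"]) auto
qed

subsection \<open>The Vershik map climbs the towers\<close>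

lemma successor_into: "bd_successor B e e' \<Longrightarrow> e \<in> into n v \<Longrightarrow> e' \<in> into n v"
  using edge_level_rng rng_in by (fastforce simp: bd_successor_def into_def)

lemma successor_unique:
  "bd_successor B e e' \<Longrightarrow> bd_successor B e e'' \<Longrightarrow> e' = e''"
  unfolding bd_successor_def using edge_le_antisym by blast

lemma successor_exists:
  assumes "e \<in> into n v" "\<not> bd_max_edge B e"
  shows "\<exists>e'. bd_successor B e e'"
proof -
  let ?j = "offset n e + height n (src e)"
  have "?j < height (Suc n) v"
    using assms max_edge_iff offset_le_height by (metis le_neq_implies_less)
  then obtain e' where e': "e' \<in> into n v" "offset n e' \<le> ?j" "?j < offset n e' + height n (src e')"
    using offset_interval_exists by blast
  have pos_h: "height n (src g) > 0" if "g \<in> into n v" for g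
    using that height_pos src_in by (auto simp: into_def)
  have "e' \<noteq> e"
    using e' by auto
  moreover have "(e, e') \<in> bd_le B"
  proof (rule ccontr)
    assume "(e, e') \<notin> bd_le B"
    then have "(e', e) \<in> bd_le B"
      using assms(1) e'(1) edge_le_total by (auto simp: into_def)
    then show False
      using offset_less[OF e'(1) assms(1)] \<open>e' \<noteq> e\<close> e'(3) by linarith
  qed
  moreover have "(e', g) \<in> bd_le B" if g: "g \<in> bd_edges B" "rng g = rng e" "(e, g) \<in> bd_le B" "g \<noteq> e" for g
  proof (rule ccontr)
    assume ng: "(e', g) \<notin> bd_le B"
    have "g \<in> E n"
      using g(1,2) assms(1) edge_level_rng[of g n] rng_in[of e n] by (auto simp: into_def)
    then have gi: "g \<in> into n v"
      using g(2) assms(1) by (auto simp: into_def)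
    then have "(g, e') \<in> bd_le B"
      using ng e'(1) edge_le_total by (auto simp: into_def)
    moreover have "g \<noteq> e'"
      using ng edge_le_refl \<open>g \<in> E n\<close> by blast
    ultimately show False
      using offset_less[OF gi e'(1)] offset_less[OF assms(1) gi] g(3,4) e'(2) pos_h[OF gi] by force
  qed
  ultimately show ?thesis
    using e'(1) assms(1) E_edges unfolding bd_successor_def by (auto simp: into_def)
qed

lemma offset_successor:
  assumes "bd_successor B e e'" "e \<in> into n v"
  shows "offset n e' = offset n e + height n (src e)"
proof -
  have e: "e \<in> E n" "e' \<in> E n" "rng e = v" "rng e' = v"
    using assms successor_into[OF assms] by (auto simp: into_def)
  have "below n e' = insert e (below n e)"
  proof (intro equalityI subsetI)
    fix g assume g: "g \<in> below n e'"
    then have gE: "g \<in> E n" "rng g = v" "(g, e') \<in> bd_le B" "g \<noteq> e'"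
      using e by (auto simp: below_def into_def)
    show "g \<in> insert e (below n e)"
    proof (rule ccontr)
      assume "g \<notin> insert e (below n e)"
      then have "g \<noteq> e" "(e, g) \<in> bd_le B"
        using gE e edge_le_total[of e n g] by (auto simp: below_def into_def)
      then have "(e', g) \<in> bd_le B"
        using assms(1) gE e E_edges by (auto simp: bd_successor_def)
      then show False
        using edge_le_antisym gE by blast
    qed
  next
    fix g assume "g \<in> insert e (below n e)"
    moreover have "(e, e') \<in> bd_le B" "e \<noteq> e'"
      using assms(1) by (auto simp: bd_successor_def)
    ultimately show "g \<in> below n e'"
      using e edge_le_trans[of g e e'] edge_le_antisym by (auto simp: below_def into_def)
  qed
  then show ?thesis
    using e offset_upto[of e n] by (simp add: offset_def)
qed

text \<open>
  The conditions in the definition of the Vershik map determine the image: the successor edge is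
  unique, and below it the path has to run along floor \<open>0\<close>.
\<close>

lemma vershik_nonmax:
  assumes x: "x \<in> paths" and "\<not> bd_max_path B x"
  obtains N where "\<forall>i<N. bd_max_edge B (x i)" "bd_vershik B x \<in> paths"
    "\<forall>i<N. bd_min_edge B (bd_vershik B x i)" "bd_successor B (x N) (bd_vershik B x N)"
    "\<forall>i>N. bd_vershik B x i = x i"
proof -
  define N where "N = (LEAST n. \<not> bd_max_edge B (x n))"
  have "\<exists>n. \<not> bd_max_edge B (x n)"
    using assms by (auto simp: bd_max_path_def)
  then have nmax: "\<not> bd_max_edge B (x N)" and max: "\<forall>i<N. bd_max_edge B (x i)"
    unfolding N_def by (metis LeastI_ex, metis not_less_Least)
  let ?Q = "\<lambda>y. y \<in> paths \<and> (\<forall>i<N. bd_min_edge B (y i)) \<and>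
                bd_successor B (x N) (y N) \<and> (\<forall>i>N. y i = x i)"
  obtain e where e: "bd_successor B (x N) e"
    using successor_exists[OF path_into[OF x] nmax] by blast
  then have eN: "e \<in> E N" "rng e = src (x (Suc N))"
    using successor_into[OF e path_into[OF x]] by (auto simp: into_def)
  have "tail_from N (x(N := e))"
    using path_tail[OF x, of N] eN by (auto simp: tail_from_def)
  moreover have "0 < height N (src ((x(N := e)) N))"
    using height_pos src_in eN by simp
  ultimately obtain y where y: "y \<in> paths" "\<forall>i\<ge>N. y i = (x(N := e)) i" "pos y N = 0"
    using floor_above_tail by blast
  have "?Q y"
    using y e pos_zero_iff[OF y(1), of N] by auto
  moreover have "y' = y" if y': "?Q y'" for y'
  proof
    fix i
    have top: "y' N = y N"
      using y' \<open>?Q y\<close> successor_unique by blast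
    have "pos y' N = pos y N"
      using y' y(3) pos_zero_iff[of y' N] by simp
    then show "y' i = y i"
      using pos_inject[of y' y N i] y' top y(1) \<open>?Q y\<close> by (metis linorder_neqE_nat)
  qed
  ultimately have "(THE y. ?Q y) = y"
    by (rule the_equality)
  then have "bd_vershik B x = y"
    using assms(2) by (simp add: bd_vershik_def Let_def N_def)
  then show thesis
    using \<open>?Q y\<close> max that by blast
qed

end

locale proper_bratteli = ordered_bratteli +
  assumes proper: "properly_ordered B"
begin

definition xmin :: "nat \<Rightarrow> 'b" where
  "xmin = (THE x. bd_min_path B x)"

lemma min_path_iff: "bd_min_path B x \<longleftrightarrow> x = xmin"
proof -
  have "\<exists>!x. bd_min_path B x"
    using proper by (simp add: properly_ordered_def)
  then show ?thesis
    unfolding xmin_def by (metis the1_equality)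
qed

lemma xmin_path: "xmin \<in> paths" and xmin_min: "bd_min_edge B (xmin i)"
  using min_path_iff[of xmin] by (auto simp: bd_min_path_def)

lemma simple: "bd_simple B"
  using proper by (simp add: properly_ordered_def)

text \<open>
  Let \<open>N\<close> be the first level at which the edge of \<open>x\<close> is not maximal. Up to level \<open>N\<close> the path is
  on the last floor and its image on the ground floor. The successor edge begins at the offset
  where the copy of the old edge ends, so at level \<open>N + 1\<close> this amounts to one floor up, and
  the common edges beyond keep it that way. The maximal path is the case without such an \<open>N\<close>.
\<close>

lemma vershik_floor:
  assumes x: "x \<in> paths"
  shows "bd_vershik B x \<in> paths"
    and "Suc (pos x n) = height n (src (x n)) \<Longrightarrow> pos (bd_vershik B x) n = 0"
    and "Suc (pos x n) \<noteq> height n (src (x n)) \<Longrightarrow>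
      src (bd_vershik B x n) = src (x n) \<and> pos (bd_vershik B x) n = Suc (pos x n)"
proof -
  let ?y = "bd_vershik B x"
  have "?y \<in> paths \<and> (if Suc (pos x n) = height n (src (x n)) then pos ?y n = 0
      else src (?y n) = src (x n) \<and> pos ?y n = Suc (pos x n))"
  proof (cases "bd_max_path B x")
    case True
    then have "?y = xmin"
      by (simp add: bd_vershik_def xmin_def)
    moreover have "Suc (pos x n) = height n (src (x n))"
      using pos_top_iff[OF x] True by (auto simp: bd_max_path_def)
    moreover have "pos xmin n = 0"
      using pos_zero_iff[OF xmin_path] xmin_min by blast
    ultimately show ?thesis
      using xmin_path by simp
  next
    case False
    then obtain N where max: "\<forall>i<N. bd_max_edge B (x i)" and y: "?y \<in> paths"
      and min: "\<forall>i<N. bd_min_edge B (?y i)" and succ: "bd_successor B (x N) (?y N)"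
      and tail: "\<forall>i>N. ?y i = x i"
      using vershik_nonmax[OF x] by blast
    have xN: "x N \<in> into N (src (x (Suc N)))"
      using path_into[OF x] .
    show ?thesis
    proof (cases "n \<le> N")
      case True
      then show ?thesis
        using pos_top_iff[OF x, of n] pos_zero_iff[OF y, of n] max min y by auto
    next
      case False
      have "pos ?y (Suc N + k) = Suc (pos x (Suc N + k))" for k
      proof (induction k)
        case 0
        have "pos ?y N = 0" "Suc (pos x N) = height N (src (x N))"
          using pos_zero_iff[OF y] pos_top_iff[OF x] max min by auto
        then show ?case
          using offset_successor[OF succ xN] by simp
      next
        case (Suc k)
        then show ?case
          using tail by simp
      qed
      from this[of "n - Suc N"] have "pos ?y n = Suc (pos x n)"
        using False by simp
      moreover have "src (?y n) = src (x n)"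
        using tail False by simp
      ultimately show ?thesis
        using y pos_less[OF y, of n] by auto
    qed
  qed
  then show "?y \<in> paths" "Suc (pos x n) = height n (src (x n)) \<Longrightarrow> pos ?y n = 0"
    "Suc (pos x n) \<noteq> height n (src (x n)) \<Longrightarrow>
      src (?y n) = src (x n) \<and> pos ?y n = Suc (pos x n)"
    by (auto split: if_splits)
qed

end

lemma cov_limit_vertex: "z \<in> cov_limit C \<Longrightarrow> z n \<in> pverts (cov_graph C n)"
  and cov_limit_map_step: "z \<in> cov_limit C \<Longrightarrow> cov_map C n (z (Suc n)) = z n"
  unfolding cov_limit_def by blast (metis (mono_tags, lifting) mem_Collect_eq)

lemma cov_comp_limit:
  assumes "z \<in> cov_limit C" "n \<le> m"
  shows "cov_comp C m n (z m) = z n"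
  using assms(2)
proof (induction m)
  case (Suc m)
  then show ?case
    using cov_limit_map_step[OF assms(1), of m] by (cases "n = Suc m") auto
qed simp

text \<open>
  A point \<open>z\<close> of the inverse limit imposes on \<open>x\<close> the conditions \<open>K x n = z n\<close>. Compatibility
  with the projections makes them nested, so one path satisfies all of them.
\<close>

lemma (in ordered_bratteli) limit_points_are_coded:
  assumes determined: "\<And>n. \<exists>m. \<forall>x y. (\<forall>i<m. x i = y i) \<longrightarrow> K x n = K y n"
    and onto: "\<And>n v. v \<in> pverts (cov_graph C n) \<Longrightarrow> \<exists>x\<in>paths. K x n = v"
    and compatible: "\<And>x n. x \<in> paths \<Longrightarrow> cov_map C n (K x (Suc n)) = K x n"
    and z: "z \<in> cov_limit C"
  shows "\<exists>x\<in>paths. K x = z"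
proof -
  obtain m where m: "\<And>n x y. \<forall>i<m n. x i = y i \<Longrightarrow> K x n = K y n"
    using determined by metis
  have "\<exists>x\<in>paths. \<forall>n. K x n = z n"
  proof (rule nested_conditions_on_paths[where m = m])
    show "(K x n = z n) = (K y n = z n)" if "\<forall>i<m n. x i = y i" for n x y
      using m[OF that] by simp
    show "K x n = z n" if "x \<in> paths" "K x (Suc n) = z (Suc n)" for n x
      using compatible[OF that(1), of n] that(2) cov_limit_map_step[OF z, of n] by simp
    show "\<exists>x\<in>paths. K x n = z n" for n
      using onto cov_limit_vertex[OF z] .
  qed
  then show ?thesis
    by auto
qed

text \<open>
  The image is unique: two candidates are joined to the same vertex of level \<open>n + 1\<close>, so by
  \<open>+\<close>directionality they agree at level \<open>n\<close>.
\<close>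

lemma cov_limit_map_eq:
  assumes C: "is_covering C" and y: "y \<in> cov_limit C"
    and arcs: "\<And>n. (x n, y n) \<in> parcs (cov_graph C n)"
  shows "cov_limit_map C x = y"
  unfolding cov_limit_map_def
proof (rule the_equality)
  show "y \<in> cov_limit C \<and> (\<forall>n. (x n, y n) \<in> parcs (cov_graph C n))"
    using y arcs by blast
next
  fix y' assume y': "y' \<in> cov_limit C \<and> (\<forall>n. (x n, y' n) \<in> parcs (cov_graph C n))"
  show "y' = y"
  proof
    fix n
    have "plus_directional (cov_graph C (Suc n)) (cov_map C n)"
      using C by (auto simp: is_covering_def is_cover_def)
    then have "cov_map C n (y' (Suc n)) = cov_map C n (y (Suc n))"
      using y' arcs unfolding plus_directional_def by blast
    then show "y' n = y n"
      using cov_limit_map_step y y' by metis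
  qed
qed

text \<open>
  The common core of both constructions: a coding of paths by vertices that respects the
  projections and sends Vershik orbits to walks is a conjugacy, provided that it is injective.
  Its inverse is continuous because a path space is compact.
\<close>

lemma (in proper_bratteli) vershik_conjugate_cov_limit:
  assumes C: "is_covering C"
    and determined: "\<And>n. \<exists>m. \<forall>x y. (\<forall>i<m. x i = y i) \<longrightarrow> K x n = K y n"
    and onto: "\<And>n v. v \<in> pverts (cov_graph C n) \<Longrightarrow> \<exists>x\<in>paths. K x n = v"
    and compatible: "\<And>x n. x \<in> paths \<Longrightarrow> cov_map C n (K x (Suc n)) = K x n"
    and step: "\<And>x n. x \<in> paths \<Longrightarrow> (K x n, K (bd_vershik B x) n) \<in> parcs (cov_graph C n)"
    and inj: "inj_on K paths"
  shows "topologically_conjugate (bd_path_space B) (bd_vershik B) (cov_limit_space C) (cov_limit_map C)"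
proof -
  let ?W = "\<lambda>n. pverts (cov_graph C n)"
  have vert: "K x n \<in> ?W n" if "x \<in> paths" for x n
  proof -
    have "pair_fin_digraph (cov_graph C n)"
      using C by (auto simp: is_covering_def is_cover_graph_def)
    then interpret pair_fin_digraph "cov_graph C n" .
    show ?thesis
      using in_arcsD1[OF step[OF that, of n]] .
  qed
  have lim: "K x \<in> cov_limit C" if "x \<in> paths" for x
    using vert[OF that] compatible[OF that] by (simp add: cov_limit_def)
  have space: "cov_limit_space C = subtopology (sequence_space ?W) (cov_limit C)"
    by (simp add: cov_limit_space_def sequence_space_def)
  have topspace: "topspace (cov_limit_space C) = cov_limit C"
    unfolding space by (auto simp: cov_limit_def)
  have "homeomorphic_map (bd_path_space B) (cov_limit_space C) K"
  proof (rule continuous_imp_homeomorphic_map)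
    show "compact_space (bd_path_space B)"
      by (rule compact_bd_path_space)
    show "Hausdorff_space (cov_limit_space C)"
      unfolding space by (intro Hausdorff_space_subtopology Hausdorff_sequence_space)
    show "K ` topspace (bd_path_space B) = topspace (cov_limit_space C)"
    proof -
      have "\<exists>x\<in>paths. K x = z" if "z \<in> cov_limit C" for z
        by (rule limit_points_are_coded[OF _ _ _ that]) (use determined onto compatible in blast)+
      then show ?thesis
        unfolding topspace using lim by auto
    qed
    show "inj_on K (topspace (bd_path_space B))"
      using inj by simp
    have "continuous_map (bd_path_space B) (discrete_topology (?W n)) (\<lambda>x. K x n)" for n
    proof -
      obtain m where m: "\<And>x y. \<forall>i<m. x i = y i \<Longrightarrow> K x n = K y n"
        using determined by metis
      have "openin (bd_path_space B) {x \<in> paths. K x n \<in> U}" for U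
      proof -
        have "openin (sequence_space E) {x. (\<forall>i. x i \<in> E i) \<and> K x n \<in> U}"
        proof (rule openin_finitely_determined)
          show "(K x n \<in> U) = (K y n \<in> U)" if "\<forall>i<m. x i = y i" for x y
            using m[OF that] by simp
        qed
        moreover have "{x \<in> paths. K x n \<in> U} = {x. (\<forall>i. x i \<in> E i) \<and> K x n \<in> U} \<inter> paths"
          by (auto simp: path_edge)
        ultimately show ?thesis
          by (auto simp: bd_path_space_subtopology openin_subtopology)
      qed
      then show ?thesis
        using vert by (simp add: continuous_map_def)
    qed
    then show "continuous_map (bd_path_space B) (cov_limit_space C) K"
      unfolding space sequence_space_def
      using lim by (auto simp: continuous_map_in_subtopology continuous_map_componentwise_UNIV)
  qed
  moreover have "K (bd_vershik B x) = cov_limit_map C (K x)" if "x \<in> paths" for x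
    using cov_limit_map_eq[OF C lim[OF vershik_floor(1)[OF that]] step[OF that]] by simp
  ultimately show ?thesis
    unfolding topologically_conjugate_def by auto
qed


section \<open>Circuits of a Gambaudo--Martens covering\<close>

lemma set_vwalk_arcs_conv_nth:
  "set (vwalk_arcs w) = {(w ! j, w ! Suc j) | j. Suc j < length w}"
proof -
  have "set (vwalk_arcs w) = (\<lambda>j. (w ! j, w ! Suc j)) ` {..<length w - 1}"
    by (induction w rule: vwalk_arcs.induct) (simp_all add: lessThan_Suc_eq_insert_0 image_image)
  then show ?thesis
    by auto
qed

locale gm_tower =
  fixes C :: "('w, 'y) gm_covering_scheme"
  assumes covering: "is_covering C"
    and level: "is_gm_level C n"
    and num_0: "gm_num C 0 = 1"
    and base_step: "cov_map C n (gm_base C (Suc n)) = gm_base C n"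
    and first_step: "i \<in> {1..gm_num C (Suc n)} \<Longrightarrow>
      cov_map C n (gm_circuit C (Suc n) i ! 1) = gm_circuit C n 1 ! 1"
begin

abbreviation "garcs n \<equiv> parcs (cov_graph C n)"
abbreviation "base \<equiv> gm_base C"
abbreviation "idx n \<equiv> {1..gm_num C n}"
abbreviation "c \<equiv> gm_circuit C"

definition len :: "nat \<Rightarrow> nat \<Rightarrow> nat" where
  "len n i = vwalk_length (c n i)"

lemma circuit: "i \<in> idx n \<Longrightarrow> is_circuit (cov_graph C n) (c n i)"
  and hd_circuit: "i \<in> idx n \<Longrightarrow> hd (c n i) = base n"
  and arcs_circuits: "garcs n = (\<Union>i\<in>idx n. set (vwalk_arcs (c n i)))"
  and inj_circuit: "inj_on (c n) (idx n)"
  using level[of n] by (auto simp: is_gm_level_def)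

lemma len_pos: "i \<in> idx n \<Longrightarrow> 0 < len n i"
  and length_circuit: "i \<in> idx n \<Longrightarrow> length (c n i) = Suc (len n i)"
  using circuit[of i n] by (auto simp: is_circuit_def len_def)

lemma circuit_start: "i \<in> idx n \<Longrightarrow> c n i ! 0 = base n"
  using hd_circuit length_circuit by (metis hd_conv_nth list.size(3) nat.distinct(1))

lemma circuit_end: "i \<in> idx n \<Longrightarrow> c n i ! len n i = base n"
proof -
  assume i: "i \<in> idx n"
  then have "c n i \<noteq> []"
    using length_circuit by (metis list.size(3) nat.distinct(1))
  then show ?thesis
    using circuit[OF i] hd_circuit[OF i] by (auto simp: is_circuit_def last_conv_nth len_def)
qed

lemma circuit_at_base:
  assumes i: "i \<in> idx n" and "j \<le> len n i" "c n i ! j = base n"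
  shows "j = 0 \<or> j = len n i"
proof (rule ccontr)
  assume j: "\<not> ?thesis"
  have "distinct (butlast (c n i))"
    using circuit[OF i] by (simp add: is_circuit_def)
  moreover have "0 < length (butlast (c n i))" "j < length (butlast (c n i))"
    using length_circuit[OF i] len_pos[OF i] j assms(2) by auto
  moreover from this have "butlast (c n i) ! j = butlast (c n i) ! 0"
    using assms(3) circuit_start[OF i] by (simp add: nth_butlast)
  ultimately show False
    using j by (metis nth_eq_iff_index_eq)
qed

lemma circuit_arc: "i \<in> idx n \<Longrightarrow> j < len n i \<Longrightarrow> (c n i ! j, c n i ! Suc j) \<in> garcs n"
  unfolding arcs_circuits set_vwalk_arcs_conv_nth using length_circuit by fastforce

lemma arc_in_circuit:
  "(u, w) \<in> garcs n \<Longrightarrow> \<exists>i\<in>idx n. \<exists>j<len n i. u = c n i ! j \<and> w = c n i ! Suc j"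
  unfolding arcs_circuits set_vwalk_arcs_conv_nth using length_circuit by fastforce

lemma circuits_merge:
  assumes "i \<in> idx n" "i' \<in> idx n" "c n i ! j = c n i' ! j'"
    and "0 < j" "j \<le> len n i" "0 < j'" "j' \<le> len n i'"
  shows "j + len n i' = j' + len n i" "j + k \<le> len n i \<Longrightarrow> c n i ! (j + k) = c n i' ! (j' + k)"
proof -
  have "j \<in> {1..vwalk_length (c n i)}" "j' \<in> {1..vwalk_length (c n i')}"
    using assms unfolding len_def by auto
  then have "\<exists>k. j + k = vwalk_length (c n i) \<and> j' + k = vwalk_length (c n i') \<and>
      (\<forall>k'\<le>k. c n i ! (j + k') = c n i' ! (j' + k'))"
    using level[of n] assms(1-3) unfolding is_gm_level_def by blast
  then obtain k0 where k0: "j + k0 = len n i" "j' + k0 = len n i'"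
      "\<forall>k'\<le>k0. c n i ! (j + k') = c n i' ! (j' + k')"
    unfolding len_def by blast
  then show "j + len n i' = j' + len n i"
    by linarith
  show "c n i ! (j + k) = c n i' ! (j' + k)" if "j + k \<le> len n i"
    using k0 that by simp
qed

text \<open>
  Two circuits with the same first step have merged there, so they coincide.
\<close>

lemma circuit_determined_by_first:
  assumes i: "i \<in> idx n" and i': "i' \<in> idx n" and eq: "c n i ! 1 = c n i' ! 1"
  shows "i = i'"
proof -
  have 1: "0 < (1::nat)" "1 \<le> len n i" "1 \<le> len n i'"
    using len_pos i i' by (auto simp: Suc_leI)
  note merge = circuits_merge[OF i i' eq 1(1,2,1,3)]
  have "c n i = c n i'"
  proof (rule nth_equalityI)
    show "length (c n i) = length (c n i')"
      using merge(1) length_circuit i i' by simp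
    show "c n i ! j = c n i' ! j" if "j < length (c n i)" for j
      using merge(2)[of "j - 1"] that length_circuit[OF i] circuit_start i i' by (cases j) auto
  qed
  then show ?thesis
    using inj_onD[OF inj_circuit _ i i'] by blast
qed

text \<open>
  Walks branch only at the base vertex, because any other circuit through an inner vertex has
  already merged with this one.
\<close>

lemma arc_from_inner_vertex:
  assumes i: "i \<in> idx n" and "(c n i ! j, w) \<in> garcs n" "0 < j" "j < len n i"
  shows "w = c n i ! Suc j"
proof -
  obtain i' j' where i': "i' \<in> idx n" "j' < len n i'" "c n i ! j = c n i' ! j'" "w = c n i' ! Suc j'"
    using arc_in_circuit[OF assms(2)] by blast
  have "0 < j'"
    using i' circuit_start[OF i'(1)] circuit_at_base[OF i, of j] assms(3,4) by (cases j') auto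
  then show ?thesis
    using circuits_merge(2)[OF i i'(1,3), of 1] i' assms by auto
qed

lemma arc_from_base:
  assumes "(base n, w) \<in> garcs n"
  shows "\<exists>i\<in>idx n. w = c n i ! 1"
proof -
  obtain i j where i: "i \<in> idx n" "j < len n i" "base n = c n i ! j" "w = c n i ! Suc j"
    using arc_in_circuit[OF assms] by blast
  then have "j = 0"
    using circuit_at_base[of i n j] by auto
  then show ?thesis
    using i by auto
qed

lemma cover_graph: "is_cover_graph (cov_graph C n)"
  and cover: "is_cover (cov_graph C (Suc n)) (cov_graph C n) (cov_map C n)"
  using covering by (auto simp: is_covering_def)

lemma arc_vertices: "(u, w) \<in> garcs n \<Longrightarrow> u \<in> pverts (cov_graph C n) \<and> w \<in> pverts (cov_graph C n)"
proof -
  interpret pair_fin_digraph "cov_graph C n"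
    using cover_graph by (simp add: is_cover_graph_def)
  show "(u, w) \<in> garcs n \<Longrightarrow> u \<in> pverts (cov_graph C n) \<and> w \<in> pverts (cov_graph C n)"
    using in_arcsD1 in_arcsD2 by blast
qed

lemma vertex_on_circuit:
  "u \<in> pverts (cov_graph C n) \<Longrightarrow> \<exists>i\<in>idx n. \<exists>j<len n i. u = c n i ! j"
  using cover_graph arc_in_circuit unfolding is_cover_graph_def by metis

lemma arc_step: "(u, w) \<in> garcs (Suc n) \<Longrightarrow> (cov_map C n u, cov_map C n w) \<in> garcs n"
  using cover[of n] by (auto simp: is_cover_def graph_hom_def)

lemma arc_lift: "(u, w) \<in> garcs n \<Longrightarrow>
    \<exists>u' w'. (u', w') \<in> garcs (Suc n) \<and> cov_map C n u' = u \<and> cov_map C n w' = w"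
proof -
  assume "(u, w) \<in> garcs n"
  then have "(u, w) \<in> map_prod (cov_map C n) (cov_map C n) ` garcs (Suc n)"
    using cover[of n] by (simp add: is_cover_def edge_surjective_def)
  then show ?thesis
    by auto
qed

lemma base_vertex: "base n \<in> pverts (cov_graph C n)"
  using level[of n] by (simp add: is_gm_level_def)

lemma one_in_idx: "1 \<in> idx n"
proof -
  obtain i where "i \<in> idx n"
    using vertex_on_circuit[OF base_vertex] by blast
  then show ?thesis
    by simp
qed

lemma len_0: "len 0 1 = 1"
proof -
  have "c 0 1 ! 1 \<in> pverts (cov_graph C 0)"
    using circuit_arc[OF one_in_idx, of 0] len_pos[OF one_in_idx] arc_vertices by fastforce
  then have "c 0 1 ! 1 = base 0"
    using covering base_vertex[of 0] by (auto simp: is_covering_def)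
  then show ?thesis
    using circuit_at_base[of 1 0 1] len_pos[of 1 0] one_in_idx[of 0] by auto
qed

subsection \<open>A circuit projects to a concatenation of circuits\<close>

definition proj :: "nat \<Rightarrow> nat \<Rightarrow> nat \<Rightarrow> 'w" where
  "proj n i a = cov_map C n (c (Suc n) i ! a)"

definition base_times :: "nat \<Rightarrow> nat \<Rightarrow> nat set" where
  "base_times n i = {a. a < len (Suc n) i \<and> proj n i a = base n}"

text \<open>
  The circuit of level \<open>n\<close> along which the image of circuit \<open>i\<close> of level \<open>n + 1\<close> leaves the base
  vertex at time \<open>a\<close>. The first step identifies it by \<open>circuit_determined_by_first\<close>.
\<close>

definition followed :: "nat \<Rightarrow> nat \<Rightarrow> nat \<Rightarrow> nat" where
  "followed n i a = (THE s. s \<in> idx n \<and> proj n i (Suc a) = c n s ! 1)"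

lemma finite_base_times [simp]: "finite (base_times n i)"
  by (simp add: base_times_def)

lemma proj_arc:
  "i \<in> idx (Suc n) \<Longrightarrow> a < len (Suc n) i \<Longrightarrow> (proj n i a, proj n i (Suc a)) \<in> garcs n"
  unfolding proj_def by (intro arc_step circuit_arc)

lemma proj_ends:
  "i \<in> idx (Suc n) \<Longrightarrow> proj n i 0 = base n" "i \<in> idx (Suc n) \<Longrightarrow> proj n i (len (Suc n) i) = base n"
  by (simp_all only: proj_def circuit_start circuit_end base_step)

lemma followed_eq: "s \<in> idx n \<Longrightarrow> proj n i (Suc a) = c n s ! 1 \<Longrightarrow> followed n i a = s"
  unfolding followed_def using circuit_determined_by_first by (intro the_equality) auto

lemma followed:
  assumes "i \<in> idx (Suc n)" "a \<in> base_times n i"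
  shows "followed n i a \<in> idx n" "proj n i (Suc a) = c n (followed n i a) ! 1"
proof -
  have "(base n, proj n i (Suc a)) \<in> garcs n"
    using proj_arc[OF assms(1), of a] assms(2) by (simp add: base_times_def)
  then obtain s where "s \<in> idx n" "proj n i (Suc a) = c n s ! 1"
    using arc_from_base by blast
  then show "followed n i a \<in> idx n" "proj n i (Suc a) = c n (followed n i a) ! 1"
    using followed_eq by auto
qed

text \<open>
  Having taken the first step of a circuit, the walk has no choice until it is back at the base
  vertex; in particular it cannot end before.
\<close>

lemma proj_follows:
  assumes i: "i \<in> idx (Suc n)" and a: "a \<in> base_times n i" and "j \<le> len n (followed n i a)"
  shows "a + j \<le> len (Suc n) i \<and> proj n i (a + j) = c n (followed n i a) ! j"
  using assms(3)
proof (induction j)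
  case 0
  then show ?case
    using a circuit_start[OF followed(1)[OF i a]] by (simp add: base_times_def)
next
  case (Suc j)
  let ?s = "followed n i a"
  have IH: "a + j \<le> len (Suc n) i" "proj n i (a + j) = c n ?s ! j"
    using Suc by auto
  show ?case
  proof (cases "j = 0")
    case True
    then show ?thesis
      using a followed(2)[OF i a] by (simp add: base_times_def)
  next
    case False
    then have "proj n i (a + j) \<noteq> base n"
      using IH(2) circuit_at_base[OF followed(1)[OF i a], of j] Suc.prems by auto
    then have less: "a + j < len (Suc n) i"
      using IH(1) proj_ends(2)[OF i] by (metis le_neq_implies_less)
    have "(c n ?s ! j, proj n i (Suc (a + j))) \<in> garcs n"
      using proj_arc[OF i less] IH(2) by simp
    then have "proj n i (Suc (a + j)) = c n ?s ! Suc j"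
      using arc_from_inner_vertex[OF followed(1)[OF i a]] False Suc.prems by simp
    then show ?thesis
      using less by simp
  qed
qed

lemma base_times_gap:
  assumes i: "i \<in> idx (Suc n)" and a: "a \<in> base_times n i" and "a < b" "proj n i b = base n"
  shows "a + len n (followed n i a) \<le> b"
proof (rule ccontr)
  assume "\<not> ?thesis"
  then have j: "b - a \<le> len n (followed n i a)" "b - a \<noteq> 0" "b - a \<noteq> len n (followed n i a)"
    using assms(3) by auto
  have "c n (followed n i a) ! (b - a) = base n"
    using proj_follows[OF i a j(1)] assms(3,4) by simp
  then show False
    using circuit_at_base[OF followed(1)[OF i a] j(1)] j(2,3) by blast
qed

lemma base_time_before:
  assumes i: "i \<in> idx (Suc n)" and "b < len (Suc n) i"
  shows "\<exists>a\<in>base_times n i. a \<le> b \<and> b < a + len n (followed n i a)"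
proof -
  let ?A = "{a \<in> base_times n i. a \<le> b}"
  have "0 \<in> ?A"
    using proj_ends(1)[OF i] len_pos[OF i] by (simp add: base_times_def)
  moreover have fin: "finite ?A"
    by simp
  ultimately have max: "Max ?A \<in> ?A"
    by (metis Max_in empty_iff)
  let ?a = "Max ?A"
  let ?e = "?a + len n (followed n i ?a)"
  have "b < ?e"
  proof (rule ccontr)
    assume "\<not> b < ?e"
    moreover have "proj n i ?e = base n"
      using proj_follows[OF i, of ?a] circuit_end[OF followed(1)[OF i]] max by simp
    ultimately have "?e \<in> ?A"
      using assms(2) by (simp add: base_times_def)
    then have "?e \<le> ?a"
      using fin by (rule Max_ge[rotated])
    then show False
      using len_pos[OF followed(1)[OF i, of ?a]] max by simp
  qed
  then show ?thesis
    using max by blast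
qed

text \<open>
  The time intervals in which the successive circuits are followed tile the circuit of level
  \<open>n + 1\<close>. This makes heights in the diagram equal to lengths of circuits and offsets equal to
  base times.
\<close>

lemma sum_followed_lengths:
  assumes i: "i \<in> idx (Suc n)" and "b \<le> len (Suc n) i" "proj n i b = base n"
  shows "(\<Sum>a | a \<in> base_times n i \<and> a < b. len n (followed n i a)) = b"
proof -
  let ?A = "{a \<in> base_times n i. a < b}"
  let ?I = "\<lambda>a. {a ..< a + len n (followed n i a)}"
  have "{..<b} = (\<Union>a\<in>?A. ?I a)"
  proof (intro equalityI subsetI)
    fix k assume "k \<in> {..<b}"
    then show "k \<in> (\<Union>a\<in>?A. ?I a)"
      using base_time_before[OF i, of k] assms(2) by fastforce
  next
    fix k assume "k \<in> (\<Union>a\<in>?A. ?I a)"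
    then show "k \<in> {..<b}"
      using base_times_gap[OF i] assms(3) by fastforce
  qed
  then have "b = card (\<Union>a\<in>?A. ?I a)"
    by (metis card_lessThan)
  also have "\<dots> = (\<Sum>a\<in>?A. card (?I a))"
  proof (rule card_UN_disjoint)
    have "?I a \<inter> ?I a' = {}" if "a \<in> ?A" "a' \<in> ?A" "a < a'" for a a'
      using that base_times_gap[OF i, of a a'] by (auto simp: base_times_def)
    then have "?I a \<inter> ?I a' = {}" if "a \<in> ?A" "a' \<in> ?A" "a \<noteq> a'" for a a'
      using that by (cases a a' rule: linorder_cases) blast+
    then show "\<forall>a\<in>?A. \<forall>a'\<in>?A. a \<noteq> a' \<longrightarrow> ?I a \<inter> ?I a' = {}"
      by blast
  qed auto
  finally show ?thesis
    by simp
qed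


section \<open>The ordered Bratteli diagram of a Gambaudo--Martens covering\<close>

definition vertex_code :: "nat \<Rightarrow> nat \<Rightarrow> nat" where
  "vertex_code n i = prod_encode (n, i)"

definition edge_code :: "nat \<Rightarrow> nat \<Rightarrow> nat \<Rightarrow> nat" where
  "edge_code n i a = prod_encode (n, prod_encode (i, a))"

text \<open>
  The edges into circuit \<open>i\<close> of level \<open>n + 1\<close> are its base times, ordered by time; such an edge
  starts at the circuit of level \<open>n\<close> that is followed from that time on. The level is part of
  the codes in order to keep the levels disjoint.
\<close>

definition diagram :: "(nat, nat) ordered_bratteli_diagram" where
  "diagram =
     \<lparr> bd_V = (\<lambda>n. vertex_code n ` idx n),
       bd_E = (\<lambda>n. {edge_code n i a | i a. i \<in> idx (Suc n) \<and> a \<in> base_times n i}),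
       bd_src = (\<lambda>e. case prod_decode e of (n, q) \<Rightarrow> case prod_decode q of (i, a) \<Rightarrow>
         vertex_code n (followed n i a)),
       bd_rng = (\<lambda>e. case prod_decode e of (n, q) \<Rightarrow> case prod_decode q of (i, a) \<Rightarrow>
         vertex_code (Suc n) i),
       bd_le = {(edge_code n i a, edge_code n i a') | n i a a'.
         i \<in> idx (Suc n) \<and> a \<in> base_times n i \<and> a' \<in> base_times n i \<and> a \<le> a'} \<rparr>"

lemma vertex_code_eq [simp]: "vertex_code n i = vertex_code n' i' \<longleftrightarrow> n = n' \<and> i = i'"
  by (simp add: vertex_code_def)

lemma edge_code_eq [simp]: "edge_code n i a = edge_code n' i' a' \<longleftrightarrow> n = n' \<and> i = i' \<and> a = a'"
  by (simp add: edge_code_def)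

lemma diagram_V: "bd_V diagram n = vertex_code n ` idx n"
  and diagram_E: "bd_E diagram n = {edge_code n i a | i a. i \<in> idx (Suc n) \<and> a \<in> base_times n i}"
  and diagram_src [simp]: "bd_src diagram (edge_code n i a) = vertex_code n (followed n i a)"
  and diagram_rng [simp]: "bd_rng diagram (edge_code n i a) = vertex_code (Suc n) i"
  and diagram_le: "bd_le diagram = {(edge_code n i a, edge_code n i a') | n i a a'.
         i \<in> idx (Suc n) \<and> a \<in> base_times n i \<and> a' \<in> base_times n i \<and> a \<le> a'}"
  by (simp_all add: diagram_def edge_code_def)

lemma zero_base_time: "i \<in> idx (Suc n) \<Longrightarrow> 0 \<in> base_times n i"
  using proj_ends(1) len_pos by (simp add: base_times_def)

text \<open>
  The first arc of a circuit is the image of an arc on some circuit one level higher, which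
  therefore passes through the base vertex and follows the given circuit from there.
\<close>

lemma circuit_is_followed:
  assumes "s \<in> idx n"
  shows "\<exists>i\<in>idx (Suc n). \<exists>a\<in>base_times n i. followed n i a = s"
proof -
  have "(base n, c n s ! 1) \<in> garcs n"
    using circuit_arc[OF assms, of 0] circuit_start[OF assms] len_pos[OF assms] by simp
  then obtain u w where "(u, w) \<in> garcs (Suc n)" "cov_map C n u = base n" "cov_map C n w = c n s ! 1"
    using arc_lift by blast
  moreover from this obtain i a where "i \<in> idx (Suc n)" "a < len (Suc n) i"
      "u = c (Suc n) i ! a" "w = c (Suc n) i ! Suc a"
    using arc_in_circuit by blast
  ultimately have "i \<in> idx (Suc n)" "a \<in> base_times n i" "followed n i a = s"
    using followed_eq[OF assms] by (auto simp: base_times_def proj_def)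
  then show ?thesis
    by blast
qed

lemma diagram_edges:
  "bd_edges diagram = {edge_code n i a | n i a. i \<in> idx (Suc n) \<and> a \<in> base_times n i}"
  by (auto simp: bd_edges_def diagram_E)

lemma diagram_bratteli: "is_bratteli_diagram diagram"
  unfolding is_bratteli_diagram_def
proof (intro conjI allI ballI)
  show "disjoint_family (bd_V diagram)" "disjoint_family (bd_E diagram)"
    by (auto simp: disjoint_family_on_def diagram_V diagram_E)
  show "finite (bd_V diagram n)" "bd_V diagram n \<noteq> {}" for n
    using one_in_idx[of n] by (auto simp: diagram_V)
  have "bd_E diagram n = (\<lambda>(i, a). edge_code n i a) ` (SIGMA i:idx (Suc n). base_times n i)" for n
    by (auto simp: diagram_E)
  then show "finite (bd_E diagram n)" for n
    by simp
  show "bd_E diagram n \<noteq> {}" for n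
    using one_in_idx[of "Suc n"] zero_base_time[of 1 n] by (auto simp: diagram_E)
  show "\<exists>v0. bd_V diagram 0 = {v0}"
    using num_0 by (simp add: diagram_V)
  show "bd_src diagram e \<in> bd_V diagram n" "bd_rng diagram e \<in> bd_V diagram (Suc n)"
    if "e \<in> bd_E diagram n" for n e
  proof -
    obtain i a where e: "e = edge_code n i a" "i \<in> idx (Suc n)" "a \<in> base_times n i"
      using \<open>e \<in> bd_E diagram n\<close> by (auto simp: diagram_E)
    then show "bd_src diagram e \<in> bd_V diagram n" "bd_rng diagram e \<in> bd_V diagram (Suc n)"
      using followed(1)[OF e(2,3)] unfolding diagram_V e(1) by auto
  qed
  show "\<exists>e\<in>bd_edges diagram. bd_src diagram e = v" if "v \<in> bd_V diagram n" for n v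
  proof -
    obtain s where s: "v = vertex_code n s" "s \<in> idx n"
      using \<open>v \<in> bd_V diagram n\<close> by (auto simp: diagram_V)
    then obtain i a where "i \<in> idx (Suc n)" "a \<in> base_times n i" "followed n i a = s"
      using circuit_is_followed by blast
    then show ?thesis
      using s(1) by (intro bexI[of _ "edge_code n i a"]) (auto simp: diagram_edges)
  qed
  show "\<exists>e\<in>bd_edges diagram. bd_rng diagram e = v" if "v \<in> bd_V diagram (Suc n)" for n v
  proof -
    obtain i where i: "v = vertex_code (Suc n) i" "i \<in> idx (Suc n)"
      using \<open>v \<in> bd_V diagram (Suc n)\<close> by (auto simp: diagram_V)
    then show ?thesis
      using zero_base_time[OF i(2)] by (intro bexI[of _ "edge_code n i 0"]) (auto simp: diagram_edges)
  qed
qed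

lemma diagram_ordered: "is_ordered_bratteli_diagram diagram"
  unfolding is_ordered_bratteli_diagram_def
proof (intro conjI diagram_bratteli)
  show "partial_order_on (bd_edges diagram) (bd_le diagram)"
    unfolding partial_order_on_def preorder_on_def
    by (auto simp: refl_on_def trans_def antisym_def diagram_edges diagram_le)
  show "\<forall>e\<in>bd_edges diagram. \<forall>e'\<in>bd_edges diagram.
      ((e, e') \<in> bd_le diagram \<or> (e', e) \<in> bd_le diagram) = (bd_rng diagram e = bd_rng diagram e')"
    by (auto simp: diagram_edges diagram_le)
qed

sublocale D: ordered_bratteli diagram
  by unfold_locales (rule diagram_ordered)

lemma diagram_into:
  "i \<in> idx (Suc n) \<Longrightarrow> D.into n (vertex_code (Suc n) i) = edge_code n i ` base_times n i"
  by (auto simp: D.into_def diagram_E)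

lemma diagram_height: "i \<in> idx n \<Longrightarrow> D.height n (vertex_code n i) = len n i"
proof (induction n arbitrary: i)
  case 0
  then show ?case
    using num_0 len_0 by simp
next
  case (Suc n)
  have "D.height (Suc n) (vertex_code (Suc n) i) = (\<Sum>a\<in>base_times n i. len n (followed n i a))"
    using Suc followed(1) by (simp add: diagram_into sum.reindex inj_on_def)
  also have "base_times n i = {a. a \<in> base_times n i \<and> a < len (Suc n) i}"
    by (auto simp: base_times_def)
  finally show ?case
    using sum_followed_lengths[OF Suc.prems order_refl proj_ends(2)[OF Suc.prems]] by simp
qed

lemma diagram_offset:
  assumes "i \<in> idx (Suc n)" "a \<in> base_times n i"
  shows "D.offset n (edge_code n i a) = a"
proof -
  have "D.below n (edge_code n i a) = edge_code n i ` {b. b \<in> base_times n i \<and> b < a}"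
    using assms by (auto simp: D.below_def diagram_into diagram_le)
  then have "D.offset n (edge_code n i a) = (\<Sum>b | b \<in> base_times n i \<and> b < a. len n (followed n i b))"
    using assms(1) followed(1) by (simp add: D.offset_def sum.reindex inj_on_def diagram_height)
  then show ?thesis
    using sum_followed_lengths[of i n a] assms by (simp add: base_times_def)
qed

subsection \<open>Paths of the diagram as points of the inverse limit\<close>

definition tower_index :: "(nat \<Rightarrow> nat) \<Rightarrow> nat \<Rightarrow> nat" where
  "tower_index x n = snd (prod_decode (bd_src diagram (x n)))"

definition point :: "(nat \<Rightarrow> nat) \<Rightarrow> nat \<Rightarrow> 'w" where
  "point x n = c n (tower_index x n) ! D.pos x n"

definition next_point :: "(nat \<Rightarrow> nat) \<Rightarrow> nat \<Rightarrow> 'w" where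
  "next_point x n = c n (tower_index x n) ! Suc (D.pos x n)"

lemma src_tower_index:
  assumes "x \<in> D.paths"
  shows "bd_src diagram (x n) = vertex_code n (tower_index x n)" "tower_index x n \<in> idx n"
  using D.path_vertex[OF assms, of n] by (auto simp: diagram_V tower_index_def vertex_code_def)

lemma pos_less_len: "x \<in> D.paths \<Longrightarrow> D.pos x n < len n (tower_index x n)"
  using D.pos_less[of x n] src_tower_index[of x n] diagram_height by simp

lemma path_edge_code:
  assumes x: "x \<in> D.paths"
  obtains a where "x n = edge_code n (tower_index x (Suc n)) a" "a \<in> base_times n (tower_index x (Suc n))"
    "followed n (tower_index x (Suc n)) a = tower_index x n" "D.pos x (Suc n) = a + D.pos x n"
proof -
  obtain i a where e: "x n = edge_code n i a" "i \<in> idx (Suc n)" "a \<in> base_times n i"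
    using D.path_edge[OF x, of n] by (auto simp: diagram_E)
  moreover have "i = tower_index x (Suc n)"
    using D.path_rng[OF x, of n] src_tower_index(1)[OF x, of "Suc n"] e(1) by simp
  moreover have "followed n i a = tower_index x n"
    using src_tower_index(1)[OF x, of n] e(1) by simp
  moreover have "D.pos x (Suc n) = a + D.pos x n"
    using e diagram_offset[OF e(2,3)] by simp
  ultimately show thesis
    using that by blast
qed

lemma point_step:
  assumes x: "x \<in> D.paths"
  shows "cov_map C n (point x (Suc n)) = point x n"
    and "cov_map C n (next_point x (Suc n)) = next_point x n"
proof -
  obtain a where a: "a \<in> base_times n (tower_index x (Suc n))"
    "followed n (tower_index x (Suc n)) a = tower_index x n" "D.pos x (Suc n) = a + D.pos x n"
    using path_edge_code[OF x] by blast
  have "proj n (tower_index x (Suc n)) (a + j) = c n (tower_index x n) ! j" if "j \<le> len n (tower_index x n)" for j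
    using proj_follows[OF src_tower_index(2)[OF x] a(1), of j] a(2) that by simp
  from this[of "D.pos x n"] this[of "Suc (D.pos x n)"]
  show "cov_map C n (point x (Suc n)) = point x n"
    "cov_map C n (next_point x (Suc n)) = next_point x n"
    using pos_less_len[OF x, of n] a(3) by (simp_all add: point_def next_point_def proj_def)
qed

lemma point_arc: "x \<in> D.paths \<Longrightarrow> (point x n, next_point x n) \<in> garcs n"
  unfolding point_def next_point_def using circuit_arc src_tower_index(2) pos_less_len by blast

lemma point_limit: "x \<in> D.paths \<Longrightarrow> point x \<in> cov_limit C"
  and next_point_limit: "x \<in> D.paths \<Longrightarrow> next_point x \<in> cov_limit C"
  unfolding cov_limit_def mem_Collect_eq using point_step point_arc arc_vertices by metis+

lemma limit_map_point: "x \<in> D.paths \<Longrightarrow> cov_limit_map C (point x) = next_point x"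
  using cov_limit_map_eq[OF covering next_point_limit] point_arc by blast

lemma point_determined: "\<exists>m. \<forall>x y. (\<forall>i<m. x i = y i) \<longrightarrow> point x n = point y n"
proof (intro exI allI impI)
  fix x y :: "nat \<Rightarrow> nat" assume "\<forall>i<Suc n. x i = y i"
  then show "point x n = point y n"
    using D.pos_cong[of n x y] by (simp add: point_def tower_index_def)
qed

lemma path_on_circuit:
  assumes "i \<in> idx n" "j < len n i"
  shows "\<exists>x\<in>D.paths. tower_index x n = i \<and> D.pos x n = j"
proof -
  have "vertex_code n i \<in> bd_V diagram n" "j < D.height n (vertex_code n i)"
    using assms diagram_height by (auto simp: diagram_V)
  then obtain x where x: "x \<in> D.paths" "bd_src diagram (x n) = vertex_code n i" "D.pos x n = j"
    using D.floor_exists by blast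
  then have "tower_index x n = i"
    using src_tower_index(1)[OF x(1), of n] by simp
  then show ?thesis
    using x by blast
qed

lemma point_onto: "v \<in> pverts (cov_graph C n) \<Longrightarrow> \<exists>x\<in>D.paths. point x n = v"
  using vertex_on_circuit path_on_circuit unfolding point_def by metis

lemma limit_point:
  assumes "z \<in> cov_limit C"
  shows "\<exists>x\<in>D.paths. point x = z"
  by (rule D.limit_points_are_coded[OF _ _ _ assms]) (use point_determined point_onto point_step(1) in blast)+

lemma limit_map_limit: "cov_limit_map C ` cov_limit C \<subseteq> cov_limit C"
  using limit_point limit_map_point next_point_limit by fastforce

lemma next_point_base_iff:
  assumes x: "x \<in> D.paths"
  shows "next_point x n = base n \<longleftrightarrow> Suc (D.pos x n) = D.height n (bd_src diagram (x n))"
proof -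
  have "next_point x n = base n \<longleftrightarrow> Suc (D.pos x n) = len n (tower_index x n)"
    using circuit_at_base[OF src_tower_index(2)[OF x], of "Suc (D.pos x n)" n] circuit_end[OF src_tower_index(2)[OF x]]
      pos_less_len[OF x, of n] by (auto simp: next_point_def Suc_le_eq)
  then show ?thesis
    using src_tower_index[OF x] diagram_height by simp
qed

lemma max_path_iff:
  assumes "x \<in> D.paths"
  shows "bd_max_path diagram x \<longleftrightarrow> next_point x = base"
proof -
  have "bd_max_path diagram x \<longleftrightarrow> (\<forall>n. \<forall>i<n. bd_max_edge diagram (x i))"
    using assms by (auto simp: bd_max_path_def)
  also have "\<dots> \<longleftrightarrow> (\<forall>n. next_point x n = base n)"
    using D.pos_top_iff[OF assms] next_point_base_iff[OF assms] by simp
  finally show ?thesis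
    by auto
qed

subsection \<open>Injectivity of the limit map makes the coding injective\<close>

text \<open>
  The preimage of \<open>point x\<close> under the limit map. It is found by moving one
  floor down at that level and keeping all edges beyond it, which makes sense before the diagram
  is known to be properly ordered.
\<close>

lemma path_one_floor_below:
  assumes x: "x \<in> D.paths" and "D.pos x n = Suc j"
  shows "\<exists>y\<in>D.paths. tower_index y n = tower_index x n \<and> D.pos y n = j \<and> next_point y = point x"
proof -
  have "j < D.height n (bd_src diagram (x n))"
    using D.pos_less[OF x, of n] assms(2) by simp
  then obtain y where y: "y \<in> D.paths" "\<forall>i\<ge>n. y i = x i" "D.pos y n = j"
    using D.floor_above_tail[OF D.path_tail[OF x]] by blast
  have eq: "next_point y (n + k) = point x (n + k)" for k
  proof -
    have "Suc (D.pos y (n + k)) = D.pos x (n + k)"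
      by (induction k) (use y assms(2) in auto)
    then show ?thesis
      using y(2) by (simp add: next_point_def point_def tower_index_def)
  qed
  have "next_point y m = point x m" for m
  proof -
    have "next_point y m = cov_comp C (n + m) m (next_point y (n + m))"
      using cov_comp_limit[OF next_point_limit[OF y(1)]] by simp
    also have "\<dots> = point x m"
      unfolding eq using cov_comp_limit[OF point_limit[OF x]] by simp
    finally show ?thesis .
  qed
  then show ?thesis
    using y by (intro bexI[of _ y]) (auto simp: tower_index_def)
qed

text \<open>
  Following the orbit of \<open>point x\<close> backwards, the base vertex of level \<open>n\<close> is met for the first
  time after \<open>pos x n\<close> steps, and the step forward from there shows which circuit it is.
  Injectivity of the limit map makes the backward orbit a function of the point.
\<close>

lemma point_determines_floor:
  assumes inj: "inj_on (cov_limit_map C) (cov_limit C)"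
    and "x \<in> D.paths" "y \<in> D.paths" "point x = point y" "D.pos x n = j"
  shows "tower_index x n = tower_index y n \<and> D.pos y n = j"
  using assms(2-)
proof (induction j arbitrary: x y)
  case 0
  have "point y n = base n"
    using 0 circuit_start[OF src_tower_index(2)[of x n]] by (metis point_def)
  then have "D.pos y n = 0"
    using circuit_at_base[OF src_tower_index(2)[of y n], of "D.pos y n"] pos_less_len[of y n] 0(2)
    by (auto simp: point_def)
  moreover have "next_point x n = next_point y n"
    using 0 limit_map_point by metis
  then have "tower_index x n = tower_index y n"
    using circuit_determined_by_first[of "tower_index x n" n "tower_index y n"] src_tower_index(2) 0 \<open>D.pos y n = 0\<close>
    by (auto simp: next_point_def)
  ultimately show ?case
    by simp
next
  case (Suc j)
  have "point x n \<noteq> base n"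
    using circuit_at_base[OF src_tower_index(2)[of x n], of "Suc j"] pos_less_len[of x n] Suc.prems
    by (auto simp: point_def)
  then have "D.pos y n \<noteq> 0"
    using circuit_start[OF src_tower_index(2)[of y n]] Suc.prems(2,3) by (metis point_def)
  then obtain k where k: "D.pos y n = Suc k"
    using not0_implies_Suc by blast
  obtain x' where x': "x' \<in> D.paths" "tower_index x' n = tower_index x n" "D.pos x' n = j" "next_point x' = point x"
    using path_one_floor_below Suc.prems(1,4) by blast
  obtain y' where y': "y' \<in> D.paths" "tower_index y' n = tower_index y n" "D.pos y' n = k" "next_point y' = point y"
    using path_one_floor_below Suc.prems(2) k by blast
  have "cov_limit_map C (point x') = cov_limit_map C (point y')"
    using limit_map_point x'(1,4) y'(1,4) Suc.prems(3) by simp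
  then have "point x' = point y'"
    using inj point_limit x'(1) y'(1) by (blast dest: inj_onD)
  then have "tower_index x' n = tower_index y' n \<and> D.pos y' n = j"
    using Suc.IH x'(1,3) y'(1) by blast
  then show ?case
    using x'(2) y'(2,3) k by simp
qed

lemma inj_point:
  assumes "inj_on (cov_limit_map C) (cov_limit C)"
  shows "inj_on point D.paths"
proof (rule inj_onI)
  fix x y assume xy: "x \<in> D.paths" "y \<in> D.paths" "point x = point y"
  have "tower_index x n = tower_index y n" "D.pos x n = D.pos y n" for n
    using point_determines_floor[OF assms xy] by auto
  then have "x i = y i" for i
    using D.pos_inject[OF xy(1,2), of "Suc i" i] src_tower_index(1)[OF xy(1)] src_tower_index(1)[OF xy(2)]
    by (simp del: D.pos.simps)
  then show "x = y"
    by blast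
qed

subsection \<open>The diagram is properly ordered\<close>

lemma base_limit: "base \<in> cov_limit C"
  unfolding cov_limit_def using base_vertex base_step by auto

text \<open>
  A path is maximal iff the limit map sends its code to the point consisting of base vertices.
\<close>

lemma unique_max_path:
  assumes "inj_on (cov_limit_map C) (cov_limit C)" "cov_limit_map C ` cov_limit C = cov_limit C"
  shows "\<exists>!x. bd_max_path diagram x"
proof (rule ex_ex1I)
  obtain z where "z \<in> cov_limit C" "cov_limit_map C z = base"
    using assms(2) base_limit by (metis imageE)
  then obtain x where "x \<in> D.paths" "next_point x = base"
    using limit_point limit_map_point by metis
  then show "\<exists>x. bd_max_path diagram x"
    using max_path_iff by blast
next
  fix x y assume max: "bd_max_path diagram x" "bd_max_path diagram y"
  then have xy: "x \<in> D.paths" "y \<in> D.paths"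
    by (auto simp: bd_max_path_def)
  then have "cov_limit_map C (point x) = cov_limit_map C (point y)"
    using max max_path_iff limit_map_point by metis
  then have "point x = point y"
    using assms(1) point_limit xy by (blast dest: inj_onD)
  then show "x = y"
    using inj_point[OF assms(1)] xy by (blast dest: inj_onD)
qed

lemma followed_first: "i \<in> idx (Suc n) \<Longrightarrow> followed n i 0 = 1"
  using followed_eq[OF one_in_idx] first_step[of i n] by (simp add: proj_def)

text \<open>
  A minimal edge has base time \<open>0\<close> and hence starts at circuit \<open>1\<close>, the common first factor of
  the images of all circuits one level higher. So the edges of a minimal path all join circuits of number \<open>1\<close>.
\<close>

lemma min_path_iff: "bd_min_path diagram x \<longleftrightarrow> x = (\<lambda>n. edge_code n 1 0)"
proof
  assume min: "bd_min_path diagram x"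
  then have x: "x \<in> D.paths" and "\<And>n. bd_min_edge diagram (x n)"
    by (auto simp: bd_min_path_def)
  then have off: "D.offset n (x n) = 0" for n
    using D.min_edge_iff D.path_edge by blast
  have e: "x n = edge_code n (tower_index x (Suc n)) 0" "tower_index x n = 1" for n
  proof -
    obtain a where a: "x n = edge_code n (tower_index x (Suc n)) a" "a \<in> base_times n (tower_index x (Suc n))"
      "followed n (tower_index x (Suc n)) a = tower_index x n"
      using path_edge_code[OF x] by blast
    moreover have "a = 0"
      using off[of n] diagram_offset[OF src_tower_index(2)[OF x] a(2)] a(1) by simp
    ultimately show "x n = edge_code n (tower_index x (Suc n)) 0" "tower_index x n = 1"
      using followed_first[OF src_tower_index(2)[OF x], of n] by auto
  qed
  show "x = (\<lambda>n. edge_code n 1 0)"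
  proof
    show "x n = edge_code n 1 0" for n
      using e(1)[of n] e(2)[of "Suc n"] by simp
  qed
next
  assume x: "x = (\<lambda>n. edge_code n 1 0)"
  have "x n \<in> bd_E diagram n" for n
    using zero_base_time[OF one_in_idx] one_in_idx[of "Suc n"] by (auto simp: x diagram_E)
  moreover from this have "bd_min_edge diagram (x n)" for n
    using D.min_edge_iff[of "x n" n] diagram_offset[OF one_in_idx zero_base_time[OF one_in_idx]]
    by (simp add: x)
  moreover have "bd_rng diagram (x n) = bd_src diagram (x (Suc n))" for n
    using followed_first[OF one_in_idx] by (simp add: x)
  ultimately show "bd_min_path diagram x"
    by (simp add: bd_min_path_def bd_paths_def)
qed

text \<open>
  If the image of circuit \<open>i\<close> of level \<open>m\<close> contains the first arc of circuit \<open>s\<close> of level \<open>n\<close>, then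
  the tower of \<open>s\<close> is traversed within the tower of \<open>i\<close>, that is, \<open>s\<close> and \<open>i\<close> lie on a common path.
\<close>

lemma connected_of_covering_arcs:
  assumes "n \<le> m" "\<And>i. i \<in> idx m \<Longrightarrow> set (vwalk_arcs (map (cov_comp C m n) (c m i))) = garcs n"
  shows "D.connected_levels n m"
  unfolding D.connected_levels_def
proof (intro ballI)
  fix u v assume "u \<in> bd_V diagram n" "v \<in> bd_V diagram m"
  then obtain s i where s: "u = vertex_code n s" "s \<in> idx n" and i: "v = vertex_code m i" "i \<in> idx m"
    by (auto simp: diagram_V)
  have "(c n s ! 0, c n s ! 1) \<in> set (vwalk_arcs (map (cov_comp C m n) (c m i)))"
    using circuit_arc[OF s(2), of 0] len_pos[OF s(2)] assms(2)[OF i(2)] by simp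
  then obtain a where a: "a < len m i" "c n s ! 0 = cov_comp C m n (c m i ! a)"
      "c n s ! 1 = cov_comp C m n (c m i ! Suc a)"
    using length_circuit[OF i(2)] by (auto simp: set_vwalk_arcs_conv_nth)
  obtain x where x: "x \<in> D.paths" "tower_index x m = i" "D.pos x m = a"
    using path_on_circuit[OF i(2) a(1)] by blast
  have "point x n = base n"
    using a(2) cov_comp_limit[OF point_limit[OF x(1)] assms(1)] x(2,3) circuit_start[OF s(2)]
    by (simp add: point_def)
  then have "D.pos x n = 0"
    using circuit_at_base[OF src_tower_index(2)[OF x(1)], of "D.pos x n" n] pos_less_len[OF x(1), of n]
    by (auto simp: point_def)
  moreover have "next_point x n = c n s ! 1"
    using a(3) cov_comp_limit[OF next_point_limit[OF x(1)] assms(1)] x(2,3)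
    by (simp add: next_point_def)
  ultimately have "tower_index x n = s"
    using circuit_determined_by_first[OF src_tower_index(2)[OF x(1)] s(2)] by (simp add: next_point_def)
  then show "\<exists>x\<in>D.paths. bd_src diagram (x n) = u \<and> bd_src diagram (x m) = v"
    using x src_tower_index(1)[OF x(1)] s(1) i(1) by blast
qed

lemma diagram_simple:
  assumes "gm_simple C"
  shows "bd_simple diagram"
proof -
  have step: "\<exists>m. True \<and> n < m \<and> D.connected_levels n m" for n
  proof (cases "n = 0")
    case True
    have "D.connected_levels 0 1"
      unfolding D.connected_levels_def
    proof (intro ballI)
      fix u v assume u: "u \<in> bd_V diagram 0" and "v \<in> bd_V diagram 1"
      then obtain x where x: "x \<in> D.paths" "bd_src diagram (x 1) = v"
        using D.path_through by blast
      moreover have "bd_src diagram (x 0) = u"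
        using D.path_vertex[OF x(1), of 0] u num_0 by (simp add: diagram_V)
      ultimately show "\<exists>x\<in>D.paths. bd_src diagram (x 0) = u \<and> bd_src diagram (x 1) = v"
        by blast
    qed
    then show ?thesis
      using True by auto
  next
    case False
    then obtain m where m: "n < m"
      "\<And>i. i \<in> idx m \<Longrightarrow> set (vwalk_arcs (map (cov_comp C m n) (c m i))) = garcs n"
      using assms False unfolding gm_simple_def by (metis neq0_conv)
    have "D.connected_levels n m"
      by (rule connected_of_covering_arcs[OF less_imp_le[OF m(1)] m(2)])
    then show ?thesis
      using m(1) by blast
  qed
  have "\<exists>t. \<forall>k. (k = 0 \<longrightarrow> t k = 0) \<and> (t k < t (Suc k) \<and> D.connected_levels (t k) (t (Suc k)))"
    by (rule dependent_nat_choice) (use step in auto)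
  then obtain t where "t 0 = 0" "\<And>k. t k < t (Suc k)" "\<And>k. D.connected_levels (t k) (t (Suc k))"
    by metis
  then show ?thesis
    unfolding D.bd_simple_iff by (auto simp: strict_mono_Suc_iff)
qed

theorem diagram_conjugate:
  assumes "gm_simple C" and inj: "inj_on (cov_limit_map C) (cov_limit C)"
    and "cov_limit_map C ` cov_limit C = cov_limit C"
  shows "properly_ordered diagram"
    and "topologically_conjugate (bd_path_space diagram) (bd_vershik diagram)
      (cov_limit_space C) (cov_limit_map C)"
proof -
  show proper: "properly_ordered diagram"
    unfolding properly_ordered_def
    using diagram_ordered diagram_simple unique_max_path min_path_iff assms by auto
  interpret P: proper_bratteli diagram
    by unfold_locales (rule proper)
  have vershik: "point (bd_vershik diagram x) n = next_point x n" if x: "x \<in> D.paths" for x n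
  proof (cases "Suc (D.pos x n) = D.height n (bd_src diagram (x n))")
    case True
    then have "D.pos (bd_vershik diagram x) n = 0" "next_point x n = base n"
      using P.vershik_floor(2)[OF x] next_point_base_iff[OF x] by auto
    then show ?thesis
      using circuit_start[OF src_tower_index(2)[OF P.vershik_floor(1)[OF x]]] by (simp add: point_def)
  next
    case False
    then show ?thesis
      using P.vershik_floor(3)[OF x False] by (simp add: point_def next_point_def tower_index_def)
  qed
  show "topologically_conjugate (bd_path_space diagram) (bd_vershik diagram)
      (cov_limit_space C) (cov_limit_map C)"
  proof (rule P.vershik_conjugate_cov_limit[where K = point])
    show "(point x n, point (bd_vershik diagram x) n) \<in> garcs n" if "x \<in> D.paths" for x n
      using point_arc[OF that] vershik[OF that] by simp
  qed (use covering point_determined point_onto point_step(1) inj_point[OF inj] in blast)+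
qed

lemma rank_diagram: "bd_rank diagram = gm_rank C"
  by (simp add: bd_rank_def gm_rank_def diagram_V card_image inj_on_def)

end

text \<open>
  The data of a covering of Gambaudo--Martens type at level \<open>0\<close> are arbitrary. Taking the loop
  of the one-vertex graph as the only circuit there lets the conditions on the levels hold
  from level \<open>0\<close> on.
\<close>

lemma gm_tower_of_covering:
  fixes C :: "'w gm_covering"
  assumes "is_gm_covering C"
  obtains C' :: "'w gm_covering" where "gm_tower C'" "gm_rank C' = gm_rank C"
    "gm_simple C' = gm_simple C" "cov_limit C' = cov_limit C"
    "cov_limit_space C' = cov_limit_space C" "cov_limit_map C' = cov_limit_map C"
proof -
  obtain v0 where v0: "pverts (cov_graph C 0) = {v0}" "parcs (cov_graph C 0) = {(v0, v0)}"
    using assms by (auto simp: is_gm_covering_def is_covering_def)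
  define C' where "C' = C\<lparr>gm_base := (gm_base C)(0 := v0), gm_num := (gm_num C)(0 := 1),
    gm_circuit := (gm_circuit C)(0 := \<lambda>_. [v0, v0])\<rparr>"
  have same: "cov_graph C' = cov_graph C" "cov_map C' = cov_map C"
    "gm_base C' = (gm_base C)(0 := v0)" "gm_num C' = (gm_num C)(0 := 1)"
    "gm_circuit C' = (gm_circuit C)(0 := \<lambda>_. [v0, v0])"
    by (simp_all add: C'_def)
  have comp: "cov_comp C' m n = cov_comp C m n" for m n
    by (induction m) (simp_all add: same fun_eq_iff)
  have limit: "cov_limit C' = cov_limit C"
    by (simp add: cov_limit_def same)
  have cov: "is_covering C" "is_covering C'"
    using assms by (auto simp: is_gm_covering_def is_covering_def same)
  have map_0: "cov_map C 0 u = v0" if "u \<in> pverts (cov_graph C 1)" for u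
  proof -
    have "is_cover (cov_graph C (Suc 0)) (cov_graph C 0) (cov_map C 0)"
      using cov(1) unfolding is_covering_def by blast
    then have "cov_map C 0 ` pverts (cov_graph C (Suc 0)) \<subseteq> {v0}"
      by (simp add: is_cover_def graph_hom_def v0)
    then show ?thesis
      using that by auto
  qed
  have "gm_tower C'"
  proof
    show "is_covering C'" "gm_num C' 0 = 1"
      using cov by (simp_all add: same)
    have level: "is_gm_level C n" if "0 < n" for n
      using assms that by (simp add: is_gm_covering_def)
    show "is_gm_level C' n" for n
    proof (cases "n = 0")
      case True
      have "j = 1" if "j \<le> 1" "1 \<le> j" for j :: nat
        using that by simp
      then show ?thesis
        using v0 unfolding is_gm_level_def True
        by (auto simp: same is_circuit_def vwalk_def with_proj_simps)
    next
      case False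
      then show ?thesis
        using level[of n] by (simp add: is_gm_level_def same)
    qed
    show "cov_map C' n (gm_base C' (Suc n)) = gm_base C' n" for n
      using assms map_0[of "gm_base C 1"] level[of 1]
      by (cases "n = 0") (simp_all add: same is_gm_covering_def is_gm_level_def)
    show "cov_map C' n (gm_circuit C' (Suc n) i ! 1) = gm_circuit C' n 1 ! 1"
      if i: "i \<in> {1..gm_num C' (Suc n)}" for i n
    proof (cases "n = 0")
      case True
      have "is_circuit (cov_graph C 1) (gm_circuit C 1 i)"
        using level[of 1] i True by (simp add: is_gm_level_def same)
      then have "gm_circuit C 1 i ! 1 \<in> pverts (cov_graph C 1)"
        by (auto simp: is_circuit_def vwalk_def intro!: subsetD[OF _ nth_mem])
      then show ?thesis
        using True map_0 by (simp add: same)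
    next
      case False
      then show ?thesis
        using assms i by (simp add: same is_gm_covering_def)
    qed
  qed
  moreover have "gm_rank C' = gm_rank C"
    unfolding gm_rank_def
    by (rule Liminf_eq) (auto simp: same eventually_sequentially intro!: exI[of _ 1])
  moreover have "gm_simple C' = gm_simple C"
  proof -
    let ?P = "\<lambda>C m n. \<forall>i\<in>{1..gm_num C m}.
      set (vwalk_arcs (map (cov_comp C m n) (gm_circuit C m i))) = parcs (cov_graph C n)"
    have "n < m \<and> ?P C' m n \<longleftrightarrow> n < m \<and> ?P C m n" for m n
      by (cases "m = 0") (simp_all add: same comp)
    then show ?thesis
      by (simp add: gm_simple_def)
  qed
  moreover have "cov_limit_space C' = cov_limit_space C"
    by (simp add: cov_limit_space_def same limit)
  moreover have "cov_limit_map C' = cov_limit_map C"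
    by (simp add: cov_limit_map_def fun_eq_iff same limit)
  ultimately show thesis
    using limit that by blast
qed

lemma conjugate_to_homeomorphism:
  assumes "topologically_conjugate Y g X f" "homeomorphic_map X X f" "g ` topspace Y \<subseteq> topspace Y"
  shows "inj_on g (topspace Y)" "g ` topspace Y = topspace Y"
proof -
  obtain u where u: "homeomorphic_map Y X u" and eq: "\<And>y. y \<in> topspace Y \<Longrightarrow> u (g y) = f (u y)"
    using assms(1) by (auto simp: topologically_conjugate_def)
  have inj_u: "inj_on u (topspace Y)" and inj_f: "inj_on f (topspace X)"
    using u assms(2) by (auto simp: homeomorphic_eq_everything_map)
  have surj_u: "u ` topspace Y = topspace X" and surj_f: "f ` topspace X = topspace X"
    using u assms(2) by (auto dest: homeomorphic_imp_surjective_map)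
  show "inj_on g (topspace Y)"
  proof (rule inj_onI)
    fix y y' assume y: "y \<in> topspace Y" "y' \<in> topspace Y" "g y = g y'"
    then have "f (u y) = f (u y')"
      using eq by metis
    then have "u y = u y'"
      using inj_f surj_u y by (blast dest: inj_onD)
    then show "y = y'"
      using inj_u y by (blast dest: inj_onD)
  qed
  show "g ` topspace Y = topspace Y"
  proof (intro equalityI assms(3) subsetI)
    fix y assume y: "y \<in> topspace Y"
    then have "u y \<in> f ` u ` topspace Y"
      using surj_f surj_u by blast
    then obtain y' where y': "y' \<in> topspace Y" "u y = f (u y')"
      by blast
    then have "g y' = y"
      using eq inj_u y assms(3) by (metis image_subset_iff inj_onD)
    then show "y \<in> g ` topspace Y"
      using y' by blast
  qed
qed

text \<open>
  Injectivity and surjectivity of \<open>f\<close> carry over to the limit map and give properness of the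
  diagram.
\<close>

theorem bratteli_of_gm_covering:
  fixes C :: "'w gm_covering"
  assumes "is_gm_covering C" "gm_simple C" "homeomorphic_map X X f"
    and "topologically_conjugate (cov_limit_space C) (cov_limit_map C) X f"
  shows "\<exists>B :: (nat, nat) ordered_bratteli_diagram. properly_ordered B \<and> bd_rank B = gm_rank C \<and>
    topologically_conjugate (bd_path_space B) (bd_vershik B) X f"
proof -
  obtain C' :: "'w gm_covering" where C': "gm_tower C'" "gm_rank C' = gm_rank C"
    "gm_simple C' = gm_simple C" "cov_limit C' = cov_limit C"
    "cov_limit_space C' = cov_limit_space C" "cov_limit_map C' = cov_limit_map C"
    using gm_tower_of_covering[OF assms(1)] by blast
  interpret gm_tower C'
    by (fact C'(1))
  have space: "topspace (cov_limit_space C') = cov_limit C'"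
    by (auto simp: cov_limit_space_def PiE_def intro: cov_limit_vertex)
  have conj: "topologically_conjugate (cov_limit_space C') (cov_limit_map C') X f"
    using assms(4) C' by simp
  note homeo = conjugate_to_homeomorphism[OF conj assms(3), unfolded space, OF limit_map_limit]
  have "properly_ordered diagram"
    "topologically_conjugate (bd_path_space diagram) (bd_vershik diagram) X f"
    using diagram_conjugate[OF _ homeo] assms(2) C'(3) topologically_conjugate_trans[OF _ conj]
    by auto
  then show ?thesis
    using rank_diagram C'(2) by auto
qed


section \<open>Choosing the levels of a Bratteli diagram\<close>

context proper_bratteli
begin

text \<open>
  Two different paths can be continued to any vertex of a sufficiently high level, where they
  end on different floors.
\<close>

lemma eventually_tall:
  assumes "x \<in> paths" "y \<in> paths" "x \<noteq> y"
  shows "\<exists>M. \<forall>n\<ge>M. \<forall>v\<in>V n. 2 \<le> height n v"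
proof -
  obtain i where i: "x i \<noteq> y i"
    using assms(3) by blast
  obtain M where M: "Suc i < M" "\<And>n. M \<le> n \<Longrightarrow> connected_levels (Suc i) n"
    using simple_eventually_connected[OF simple] by blast
  have "2 \<le> height n v" if n: "M \<le> n" and v: "v \<in> V n" for n v
  proof -
    \<comment> \<open>Keep the edge number \<open>i\<close>, at which \<open>x\<close> and \<open>y\<close> differ, and then continue to \<open>v\<close>.\<close>
    have splice: "\<exists>z\<in>paths. src (z n) = v \<and> z i = w i" if w: "w \<in> paths" for w
    proof -
      obtain u where u: "u \<in> paths" "src (u (Suc i)) = src (w (Suc i))" "src (u n) = v"
        using M(2)[OF n] path_vertex[OF w] v unfolding connected_levels_def by blast
      let ?z = "\<lambda>k. if k < Suc i then w k else u k"
      have "?z \<in> paths"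
        using splice_paths[OF w u(1)] u(2) by simp
      moreover have "src (?z n) = v" "?z i = w i"
        using u(3) n M(1) by auto
      ultimately show ?thesis
        by (intro bexI[of _ ?z] conjI)
    qed
    obtain x' where x': "x' \<in> paths" "src (x' n) = v" "x' i = x i"
      using splice[OF assms(1)] by blast
    obtain y' where y': "y' \<in> paths" "src (y' n) = v" "y' i = y i"
      using splice[OF assms(2)] by blast
    have "pos x' n \<noteq> pos y' n"
      using pos_inject[OF x'(1) y'(1), of n i] x' y' i n M(1) by auto
    then show ?thesis
      using pos_less[OF x'(1), of n] pos_less[OF y'(1), of n] x'(2) y'(2) by simp
  qed
  then show ?thesis
    by blast
qed

lemma pos_zero_mono: "x \<in> paths \<Longrightarrow> pos x n = 0 \<Longrightarrow> m \<le> n \<Longrightarrow> pos x m = 0"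
  using pos_zero_iff by (metis order_less_le_trans)

lemma min_path_of_pos_zero:
  assumes "x \<in> paths" "\<And>n. pos x (f n) = 0" "\<And>n. n \<le> f n"
  shows "x = xmin"
proof -
  have "bd_min_edge B (x i)" for i
    using pos_zero_iff[OF assms(1), of "f (Suc i)"] assms(2)[of "Suc i"] assms(3)[of "Suc i"] by auto
  then have "bd_min_path B x"
    using assms(1) by (simp add: bd_min_path_def)
  then show ?thesis
    using min_path_iff by blast
qed

text \<open>
  The ground floors of all towers together shrink to the minimal path, hence at a high level
  they all lie in one tower of level \<open>m\<close>.
\<close>

lemma eventually_ground_floor_over_xmin:
  "\<exists>M. \<forall>n\<ge>M. \<forall>x\<in>paths. pos x n = 0 \<longrightarrow> src (x m) = src (xmin m)"
proof -
  let ?P = "\<lambda>k x. pos x (m + k) = 0 \<and> src (x m) \<noteq> src (xmin m)"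
  have "\<exists>k. \<forall>x\<in>paths. \<not> ?P k x"
  proof (rule ccontr)
    assume "\<not> ?thesis"
    then have nonempty: "\<exists>x\<in>paths. ?P k x" for k
      by blast
    have "\<exists>x\<in>paths. \<forall>k. ?P k x"
    proof (rule nested_conditions_on_paths[where m = "\<lambda>k. Suc (m + k)", OF _ _ nonempty])
      show "?P k x = ?P k y" if "\<forall>i<Suc (m + k). x i = y i" for k x y
        using pos_cong[of "m + k" x y] that by simp
      show "?P k x" if "x \<in> paths" "?P (Suc k) x" for k x
        using pos_zero_mono[OF that(1), of "m + Suc k" "m + k"] that(2) by (simp del: pos.simps)
    qed
    then obtain x where "x \<in> paths" "\<And>k. pos x (m + k) = 0" "src (x m) \<noteq> src (xmin m)"
      by blast
    then show False
      using min_path_of_pos_zero[of x "\<lambda>k. m + k"] by simp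
  qed
  then obtain k where k: "\<And>x. x \<in> paths \<Longrightarrow> \<not> ?P k x"
    by blast
  have "src (x m) = src (xmin m)" if "m + k \<le> n" "x \<in> paths" "pos x n = 0" for n x
    using k[OF that(2)] pos_zero_mono[OF that(2,3,1)] by blast
  then show ?thesis
    by blast
qed

end


section \<open>The Gambaudo--Martens covering of a properly ordered Bratteli diagram\<close>

text \<open>
  The chosen levels \<open>t n\<close> of the diagram. By \<open>ground\<close>, identifying the ground floors of level
  \<open>t (n + 1)\<close> still leaves tower and floor at level \<open>t n\<close> well defined; by \<open>tall\<close>, the circuits
  arising from different towers have different second vertices.
\<close>

locale collapsed_towers = proper_bratteli B
  for B :: "('v :: countable, 'e, 'x) ordered_bratteli_diagram_scheme" +
  fixes t :: "nat \<Rightarrow> nat"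
  assumes t_0: "t 0 = 0" and t_less: "t n < t (Suc n)"
    and tall: "v \<in> V (t (Suc n)) \<Longrightarrow> 2 \<le> height (t (Suc n)) v"
    and ground: "x \<in> paths \<Longrightarrow> pos x (t (Suc n)) = 0 \<Longrightarrow> src (x (t n)) = src (xmin (t n))"
    and connected: "connected_levels (t n) (t (Suc n))"
begin

abbreviation ht :: "nat \<Rightarrow> 'v \<Rightarrow> nat" where
  "ht n v \<equiv> height (t n) v"

text \<open>
  The ground floors of the towers of one level become a single vertex, coded by \<open>0\<close>, to which
  every tower returns after its last floor.
\<close>

definition node :: "nat \<Rightarrow> 'v \<Rightarrow> nat \<Rightarrow> nat" where
  "node n v j = (if j = 0 \<or> j = ht n v then 0 else Suc (to_nat (v, j)))"

definition floor_node :: "(nat \<Rightarrow> 'e) \<Rightarrow> nat \<Rightarrow> nat" where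
  "floor_node x n = node n (src (x (t n))) (pos x (t n))"

definition next_node :: "(nat \<Rightarrow> 'e) \<Rightarrow> nat \<Rightarrow> nat" where
  "next_node x n = node n (src (x (t n))) (Suc (pos x (t n)))"

text \<open>
  The arcs lead one floor up, and from the last floor of each tower to the merged ground floor.
  Describing both vertices and arcs by the paths passing through them reduces the covering
  conditions to statements about \<open>floor_node\<close> and \<open>next_node\<close>.
\<close>

definition graph :: "nat \<Rightarrow> nat pair_pre_digraph" where
  "graph n = \<lparr> pverts = (\<lambda>x. floor_node x n) ` paths,
               parcs = (\<lambda>x. (floor_node x n, next_node x n)) ` paths \<rparr>"

text \<open>
  The choice of the path does not matter, by \<open>floor_node_determines_lower_floor\<close>.
\<close>

definition project :: "nat \<Rightarrow> nat \<Rightarrow> nat" where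
  "project n u = floor_node (SOME x. x \<in> paths \<and> floor_node x (Suc n) = u) n"

definition circuit :: "nat \<Rightarrow> 'v \<Rightarrow> nat list" where
  "circuit n v = map (node n v) [0..<Suc (ht n v)]"

text \<open>
  The tower of the minimal path gets the number \<open>1\<close>, since it is the one in which the merged
  ground floor of the next level continues.
\<close>

definition enum :: "nat \<Rightarrow> nat \<Rightarrow> 'v" where
  "enum n = (SOME g. bij_betw g {1..card (V (t n))} (V (t n)) \<and> g 1 = src (xmin (t n)))"

definition gm :: "nat gm_covering" where
  "gm = \<lparr> cov_graph = graph, cov_map = project, gm_base = (\<lambda>n. 0),
          gm_num = (\<lambda>n. card (V (t n))), gm_circuit = (\<lambda>n i. circuit n (enum n i)) \<rparr>"

lemma gm_simps [simp]: "cov_graph gm = graph" "cov_map gm = project" "gm_base gm n = 0"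
  "gm_num gm n = card (V (t n))" "gm_circuit gm n i = circuit n (enum n i)"
  by (simp_all add: gm_def)

lemma graph_simps [simp]: "pverts (graph n) = (\<lambda>x. floor_node x n) ` paths"
  "parcs (graph n) = (\<lambda>x. (floor_node x n, next_node x n)) ` paths"
  by (simp_all add: graph_def)

lemma t_increasing: "n \<le> t n"
  by (induction n) (use t_less Suc_leI order_le_less_trans in blast)+

lemma t_mono: "m \<le> n \<Longrightarrow> t m \<le> t n"
  using t_less by (simp add: lift_Suc_mono_le less_imp_le)

lemma enum: "bij_betw (enum n) {1..card (V (t n))} (V (t n))" "enum n 1 = src (xmin (t n))"
proof -
  let ?A = "V (t n)" and ?v = "src (xmin (t n))"
  have v: "?v \<in> ?A"
    using path_vertex[OF xmin_path] .
  obtain g where g: "bij_betw g {1..card ?A} ?A"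
    using ex_bij_betw_nat_finite_1 finite_V by blast
  then obtain k where k: "k \<in> {1..card ?A}" "g k = ?v"
    using v by (metis bij_betw_def imageE)
  \<comment> \<open>Swap the number of the tower of the minimal path with the number \<open>1\<close>.\<close>
  let ?s = "Transposition.transpose 1 k"
  have "bij_betw ?s {1..card ?A} {1..card ?A}"
    using k(1) by (intro bij_betw_transpose_iff) auto
  then have "bij_betw (g \<circ> ?s) {1..card ?A} ?A \<and> (g \<circ> ?s) 1 = ?v"
    using bij_betw_trans g k(2) by auto
  then have "bij_betw (enum n) {1..card ?A} ?A \<and> enum n 1 = ?v"
    unfolding enum_def by (rule someI[of _ "g \<circ> ?s"])
  then show "bij_betw (enum n) {1..card (V (t n))} (V (t n))" "enum n 1 = src (xmin (t n))"
    by auto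
qed

lemma enum_in: "i \<in> {1..card (V (t n))} \<Longrightarrow> enum n i \<in> V (t n)"
  using enum(1) bij_betwE by blast

lemma node_zero_iff: "node n v j = 0 \<longleftrightarrow> j = 0 \<or> j = ht n v"
  by (simp add: node_def)

lemma node_inject:
  "node n v j = node n v' j' \<Longrightarrow> node n v j \<noteq> 0 \<Longrightarrow> v = v' \<and> j = j'"
  by (auto simp: node_def split: if_splits)

lemma floor_node_zero_iff: "x \<in> paths \<Longrightarrow> floor_node x n = 0 \<longleftrightarrow> pos x (t n) = 0"
  using pos_less[of x "t n"] by (simp add: floor_node_def node_zero_iff)

lemma floor_node_inject:
  assumes "x \<in> paths" "y \<in> paths" "floor_node x n = floor_node y n" "pos x (t n) \<noteq> 0"
  shows "src (x (t n)) = src (y (t n)) \<and> pos x (t n) = pos y (t n)"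
  using node_inject[of n "src (x (t n))" "pos x (t n)" "src (y (t n))" "pos y (t n)"]
    floor_node_zero_iff[OF assms(1), of n] assms(3,4) by (simp add: floor_node_def)

text \<open>
  Here the merging pays off: from a last floor the Vershik map may lead into any tower, but
  always to the same node.
\<close>

lemma floor_node_vershik:
  assumes "x \<in> paths"
  shows "floor_node (bd_vershik B x) n = next_node x n"
  using vershik_floor(2,3)[OF assms, of "t n"]
  by (cases "Suc (pos x (t n)) = ht n (src (x (t n)))") (auto simp: floor_node_def next_node_def node_def)

lemma node_on_path:
  assumes "v \<in> V (t n)" "j < ht n v"
  obtains x where "x \<in> paths" "src (x (t n)) = v" "pos x (t n) = j"
    "node n v j = floor_node x n" "node n v (Suc j) = next_node x n"
  using floor_exists[OF assms] that unfolding floor_node_def next_node_def by blast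

lemma node_arc:
  assumes "v \<in> V (t n)" "j < ht n v"
  shows "(node n v j, node n v (Suc j)) \<in> parcs (graph n)"
proof -
  obtain x where "x \<in> paths" "node n v j = floor_node x n" "node n v (Suc j) = next_node x n"
    using node_on_path[OF assms] by blast
  then show ?thesis
    by simp
qed

text \<open>
  This is where the choice of the levels is used: although the ground floors of level \<open>n + 1\<close>
  are identified, their paths are on one and the same floor of one tower of level \<open>n\<close>.
\<close>

lemma floor_node_determines_lower_floor:
  assumes x: "x \<in> paths" and y: "y \<in> paths" and eq: "floor_node x (Suc n) = floor_node y (Suc n)"
  shows "src (x (t n)) = src (y (t n)) \<and> pos x (t n) = pos y (t n)"
proof (cases "pos x (t (Suc n)) = 0")
  case True
  then have "pos y (t (Suc n)) = 0"
    using floor_node_zero_iff x y eq by metis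
  then show ?thesis
    using True ground x y pos_zero_mono[OF x, of "t (Suc n)"] pos_zero_mono[OF y, of "t (Suc n)"]
      t_less[of n] by simp
next
  case False
  then show ?thesis
    using floor_node_inject[OF x y eq] pos_determines_lower[OF x y _ _ less_imp_le[OF t_less]] by simp
qed

lemma project_floor_node:
  assumes x: "x \<in> paths"
  shows "project n (floor_node x (Suc n)) = floor_node x n"
proof -
  let ?y = "SOME y. y \<in> paths \<and> floor_node y (Suc n) = floor_node x (Suc n)"
  have "?y \<in> paths \<and> floor_node ?y (Suc n) = floor_node x (Suc n)"
    by (rule someI[of _ x]) (use x in simp)
  then show ?thesis
    using floor_node_determines_lower_floor[of ?y x n] x by (simp add: project_def floor_node_def)
qed

lemma project_next_node: "x \<in> paths \<Longrightarrow> project n (next_node x (Suc n)) = next_node x n"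
  using project_floor_node[of "bd_vershik B x" n] vershik_floor(1) floor_node_vershik by simp

lemma next_node_vertex: "x \<in> paths \<Longrightarrow> next_node x n \<in> pverts (graph n)"
  using vershik_floor(1) floor_node_vershik by (metis graph_simps(1) imageI)

lemma zero_vertex: "floor_node xmin n = 0"
proof -
  have "pos xmin (t n) = 0"
    using pos_zero_iff[OF xmin_path] xmin_min by blast
  then show ?thesis
    using floor_node_zero_iff[OF xmin_path] by simp
qed

lemma graph_cover_graph: "is_cover_graph (graph n)"
  unfolding is_cover_graph_def
proof (intro conjI ballI)
  have "pverts (graph n) \<subseteq> (\<lambda>(v, j). node n v j) ` (SIGMA v:V (t n). {..<ht n v})"
    using path_vertex pos_less by (fastforce simp: floor_node_def)
  then have fin: "finite (pverts (graph n))"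
    by (rule finite_subset) simp
  have sub: "parcs (graph n) \<subseteq> pverts (graph n) \<times> pverts (graph n)"
    using next_node_vertex by auto
  then have "finite (parcs (graph n))"
    using fin by (meson finite_SigmaI finite_subset)
  then show "pair_fin_digraph (graph n)"
    using fin sub by unfold_locales auto
  fix u assume "u \<in> pverts (graph n)"
  then obtain x where x: "x \<in> paths" "u = floor_node x n"
    by auto
  then show "\<exists>w. (u, w) \<in> parcs (graph n)"
    by auto
  let ?v = "src (x (t n))"
  have h: "0 < ht n ?v" "pos x (t n) < ht n ?v"
    using height_pos path_vertex pos_less x(1) by auto
  \<comment> \<open>A node on the ground floor is entered from the last floor of any tower.\<close>
  define j where "j = (if pos x (t n) = 0 then ht n ?v - 1 else pos x (t n) - 1)"
  have j: "j < ht n ?v" "node n ?v (Suc j) = u"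
    using h x(2) by (auto simp: j_def floor_node_def node_def)
  then obtain y where "y \<in> paths" "next_node y n = u"
    using node_on_path[OF path_vertex[OF x(1)] j(1)] by metis
  then show "\<exists>w. (w, u) \<in> parcs (graph n)"
    by auto
qed

lemma graph_cover: "is_cover (graph (Suc n)) (graph n) (project n)"
  unfolding is_cover_def
proof (intro conjI)
  show "graph_hom (graph (Suc n)) (graph n) (project n)"
    by (auto simp: graph_hom_def project_floor_node project_next_node)
  show "edge_surjective (graph (Suc n)) (graph n) (project n)"
    by (simp add: edge_surjective_def image_image project_floor_node project_next_node)
  show "plus_directional (graph (Suc n)) (project n)"
    unfolding plus_directional_def
  proof (intro allI impI)
    fix u w w' assume "(u, w) \<in> parcs (graph (Suc n)) \<and> (u, w') \<in> parcs (graph (Suc n))"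
    then obtain x y where x: "x \<in> paths" "u = floor_node x (Suc n)" "w = next_node x (Suc n)"
      and y: "y \<in> paths" "u = floor_node y (Suc n)" "w' = next_node y (Suc n)"
      by auto
    have "src (x (t n)) = src (y (t n)) \<and> pos x (t n) = pos y (t n)"
      by (rule floor_node_determines_lower_floor[OF x(1) y(1)]) (use x(2) y(2) in simp)
    then have "next_node x n = next_node y n"
      by (simp add: next_node_def)
    then show "project n w = project n w'"
      using project_next_node x y by simp
  qed
qed

lemma gm_is_covering: "is_covering gm"
proof -
  have "floor_node x 0 = 0" "next_node x 0 = 0" for x
    by (simp_all add: floor_node_def next_node_def node_def t_0)
  then have "pverts (graph 0) = {0}" "parcs (graph 0) = {(0, 0)}"
    using xmin_path by auto
  then show ?thesis
    unfolding is_covering_def using graph_cover_graph graph_cover by auto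
qed

lemma length_circuit [simp]: "length (circuit n v) = Suc (ht n v)"
  by (simp add: circuit_def)

lemma circuit_nth [simp]: "j \<le> ht n v \<Longrightarrow> circuit n v ! j = node n v j"
  unfolding circuit_def by (subst nth_map) (auto simp del: upt_Suc)

lemma circuit_arcs:
  "set (vwalk_arcs (circuit n v)) = {(node n v j, node n v (Suc j)) | j. j < ht n v}"
  unfolding set_vwalk_arcs_conv_nth
  by (intro Collect_cong ex_cong1) (auto simp: Suc_le_eq)

lemma circuit_is_circuit:
  assumes v: "v \<in> V (t n)"
  shows "is_circuit (graph n) (circuit n v)" "hd (circuit n v) = 0"
proof -
  note arcs = node_arc[OF v]
  have node_vertex: "node n v j \<in> pverts (graph n)" if "j \<le> ht n v" for j
  proof (cases "j = ht n v")
    case True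
    then show ?thesis
      using zero_vertex xmin_path by (auto simp: node_def intro: rev_image_eqI)
  next
    case False
    then have "j < ht n v"
      using that by simp
    then obtain x where "x \<in> paths" "node n v j = floor_node x n"
      using node_on_path[OF v] by blast
    then show ?thesis
      by simp
  qed
  have "set (circuit n v) \<subseteq> pverts (graph n)"
  proof
    fix u assume "u \<in> set (circuit n v)"
    then obtain j where "j < length (circuit n v)" "u = circuit n v ! j"
      by (metis in_set_conv_nth)
    then show "u \<in> pverts (graph n)"
      using node_vertex[of j] by simp
  qed
  moreover have "circuit n v \<noteq> []"
    by (simp add: circuit_def)
  ultimately have "vwalk (circuit n v) (with_proj (graph n))"
    using arcs unfolding vwalk_def with_proj_simps circuit_arcs by blast
  moreover have "hd (circuit n v) = 0" "last (circuit n v) = 0"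
    using \<open>circuit n v \<noteq> []\<close> by (simp_all add: hd_conv_nth last_conv_nth node_def)
  moreover have "distinct (butlast (circuit n v))"
  proof -
    have "inj_on (node n v) {0..<ht n v}"
      by (auto simp: inj_on_def node_def split: if_splits)
    then show ?thesis
      by (simp add: circuit_def distinct_map)
  qed
  moreover have "1 \<le> vwalk_length (circuit n v)"
    using height_pos[OF v] by simp
  ultimately show "is_circuit (graph n) (circuit n v)" "hd (circuit n v) = 0"
    by (simp_all add: is_circuit_def)
qed

lemma gm_is_level:
  assumes "0 < n"
  shows "is_gm_level gm n"
  unfolding is_gm_level_def gm_simps
proof (intro conjI ballI impI)
  have two: "2 \<le> ht n v" if "v \<in> V (t n)" for v
    using tall[of v "n - 1"] assms that by simp
  let ?I = "{1..card (V (t n))}"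
  show "0 \<in> pverts (graph n)"
    using zero_vertex xmin_path by (auto intro: rev_image_eqI)
  show "inj_on (\<lambda>i. circuit n (enum n i)) ?I"
  proof (rule inj_onI)
    fix i i' assume i: "i \<in> ?I" "i' \<in> ?I" "circuit n (enum n i) = circuit n (enum n i')"
    have "2 \<le> ht n (enum n i)" "2 \<le> ht n (enum n i')"
      using two enum_in i by auto
    then have "node n (enum n i) 1 = node n (enum n i') 1" "node n (enum n i) 1 \<noteq> 0"
      using i(3) circuit_nth[of 1 n "enum n i"] circuit_nth[of 1 n "enum n i'"]
      by (auto simp: node_zero_iff simp del: circuit_nth)
    then have "enum n i = enum n i'"
      using node_inject by blast
    then show "i = i'"
      using enum(1) i by (metis bij_betw_def inj_onD)
  qed
  show "is_circuit (graph n) (circuit n (enum n i))" "hd (circuit n (enum n i)) = 0" if "i \<in> ?I" for i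
    using circuit_is_circuit enum_in[OF that] by auto
  have "(\<Union>i\<in>?I. set (vwalk_arcs (circuit n (enum n i)))) =
      (\<Union>v\<in>enum n ` ?I. set (vwalk_arcs (circuit n v)))"
    by simp
  also have "enum n ` ?I = V (t n)"
    using enum(1) by (rule bij_betw_imp_surj_on)
  also have "(\<Union>v\<in>V (t n). set (vwalk_arcs (circuit n v))) = parcs (graph n)"
  proof (intro equalityI subsetI)
    fix a assume "a \<in> (\<Union>v\<in>V (t n). set (vwalk_arcs (circuit n v)))"
    then obtain v j where v: "v \<in> V (t n)" "j < ht n v" "a = (node n v j, node n v (Suc j))"
      by (auto simp: circuit_arcs)
    then show "a \<in> parcs (graph n)"
      using node_arc[OF v(1,2)] by simp
  next
    fix a assume "a \<in> parcs (graph n)"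
    then obtain x where "x \<in> paths" "a = (floor_node x n, next_node x n)"
      by auto
    then show "a \<in> (\<Union>v\<in>V (t n). set (vwalk_arcs (circuit n v)))"
      using path_vertex pos_less by (fastforce simp: circuit_arcs floor_node_def next_node_def)
  qed
  finally show "(\<Union>i\<in>?I. set (vwalk_arcs (circuit n (enum n i)))) = parcs (graph n)" .
  fix i i' j j'
  assume ii: "i \<in> ?I" "i' \<in> ?I"
    and "j \<in> {1..vwalk_length (circuit n (enum n i))}" "j' \<in> {1..vwalk_length (circuit n (enum n i'))}"
    and "circuit n (enum n i) ! j = circuit n (enum n i') ! j'"
  then have j: "1 \<le> j" "j \<le> ht n (enum n i)" "1 \<le> j'" "j' \<le> ht n (enum n i')"
    and eq: "node n (enum n i) j = node n (enum n i') j'"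
    by auto
  show "\<exists>k. j + k = vwalk_length (circuit n (enum n i)) \<and> j' + k = vwalk_length (circuit n (enum n i')) \<and>
      (\<forall>k'\<le>k. circuit n (enum n i) ! (j + k') = circuit n (enum n i') ! (j' + k'))"
  proof (cases "j = ht n (enum n i)")
    case True
    then have "j' = ht n (enum n i')"
      using eq j by (auto simp: node_def split: if_splits)
    then show ?thesis
      using True eq by (intro exI[of _ 0]) simp
  next
    case False
    then have "enum n i = enum n i' \<and> j = j'"
      using node_inject[OF eq] j(1) by (auto simp: node_zero_iff)
    then show ?thesis
      using j by (intro exI[of _ "ht n (enum n i) - j"]) simp
  qed
qed

lemma gm_is_gm_covering: "is_gm_covering gm"
  unfolding is_gm_covering_def
proof (intro conjI allI impI ballI gm_is_covering)
  fix n :: nat assume n: "0 < n"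
  show "is_gm_level gm n"
    by (rule gm_is_level[OF n])
  show "cov_map gm n (gm_base gm (Suc n)) = gm_base gm n"
    using project_floor_node[OF xmin_path, of n] zero_vertex by simp
  fix i assume i: "i \<in> {1..gm_num gm (Suc n)}"
  let ?v = "enum (Suc n) i"
  have v: "?v \<in> V (t (Suc n))"
    using enum_in i by simp
  have h: "2 \<le> ht (Suc n) ?v"
    using tall[OF v] .
  then have "0 < ht (Suc n) ?v"
    by simp
  then obtain x where x: "x \<in> paths" "pos x (t (Suc n)) = 0" "node (Suc n) ?v (Suc 0) = next_node x (Suc n)"
    using node_on_path[OF v] by metis
  have "src (x (t n)) = enum n 1" "pos x (t n) = 0"
    using ground x enum(2) pos_zero_mono[OF x(1,2)] t_less[of n] by auto
  moreover have "1 \<le> ht n (enum n 1)"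
    using height_pos[OF path_vertex[OF xmin_path], of "t n"] enum(2) by simp
  ultimately show "cov_map gm n (gm_circuit gm (Suc n) i ! 1) = gm_circuit gm n 1 ! 1"
    using project_next_node[OF x(1), of n] x(3) h by (simp add: next_node_def)
qed

lemma gm_is_simple: "gm_simple gm"
  unfolding gm_simple_def
proof (intro allI impI)
  fix n :: nat assume "0 < n"
  have "set (vwalk_arcs (map (project n) (circuit (Suc n) v))) = parcs (graph n)"
    if v: "v \<in> V (t (Suc n))" for v
  proof -
    have "set (vwalk_arcs (map (project n) (circuit (Suc n) v))) =
        {(project n (node (Suc n) v j), project n (node (Suc n) v (Suc j))) | j. j < ht (Suc n) v}"
      unfolding set_vwalk_arcs_conv_nth
      by (intro Collect_cong ex_cong1) (auto simp: Suc_le_eq nth_map simp del: nth_map_upt)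
    also have "\<dots> = parcs (graph n)"
    proof (intro equalityI subsetI)
      fix a assume "a \<in> {(project n (node (Suc n) v j), project n (node (Suc n) v (Suc j))) | j. j < ht (Suc n) v}"
      then obtain j where j: "j < ht (Suc n) v"
        "a = (project n (node (Suc n) v j), project n (node (Suc n) v (Suc j)))"
        by blast
      obtain x where "x \<in> paths" "node (Suc n) v j = floor_node x (Suc n)"
        "node (Suc n) v (Suc j) = next_node x (Suc n)"
        using node_on_path[OF v j(1)] by metis
      then show "a \<in> parcs (graph n)"
        using j(2) by (simp add: project_floor_node project_next_node)
    next
      fix a assume "a \<in> parcs (graph n)"
      then obtain y where y: "y \<in> paths" "a = (floor_node y n, next_node y n)"
        by auto
      obtain z where z: "z \<in> paths" "src (z (t n)) = src (y (t n))" "src (z (t (Suc n))) = v"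
        using connected[of n] path_vertex[OF y(1)] v unfolding connected_levels_def by blast
      let ?x = "\<lambda>i. if i < t n then y i else z i"
      have x: "?x \<in> paths"
        using splice_paths[OF y(1) z(1)] z(2) by simp
      have xv: "src (?x (t (Suc n))) = v"
        using z(3) t_less[of n] by simp
      have "src (?x (t n)) = src (y (t n))" "pos ?x (t n) = pos y (t n)"
        using z(2) by (simp, intro pos_cong) simp
      then have "a = (floor_node ?x n, next_node ?x n)"
        by (simp add: y(2) floor_node_def next_node_def)
      also have "\<dots> = (project n (floor_node ?x (Suc n)), project n (next_node ?x (Suc n)))"
        using project_floor_node[OF x] project_next_node[OF x] by simp
      also have "\<dots> = (project n (node (Suc n) v (pos ?x (t (Suc n)))),
          project n (node (Suc n) v (Suc (pos ?x (t (Suc n))))))"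
        unfolding floor_node_def[of ?x "Suc n"] next_node_def[of ?x "Suc n"] xv ..
      finally show "a \<in> {(project n (node (Suc n) v j), project n (node (Suc n) v (Suc j))) | j. j < ht (Suc n) v}"
        using pos_less[OF x, of "t (Suc n)"] unfolding xv by blast
    qed
    finally show ?thesis .
  qed
  moreover have "cov_comp gm (Suc n) n = project n"
    by (cases n) (simp_all add: fun_eq_iff)
  ultimately show "\<exists>m>n. \<forall>i\<in>{1..gm_num gm m}.
      set (vwalk_arcs (map (cov_comp gm m n) (gm_circuit gm m i))) = parcs (cov_graph gm n)"
    using enum_in by (intro exI[of _ "Suc n"]) simp
qed

text \<open>
  Two paths with the same code are on the ground floor at the same levels. If these are all
  levels, both paths are minimal; otherwise the code shows tower and floor at all high levels.
\<close>

lemma inj_floor_node: "inj_on floor_node paths"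
proof (rule inj_onI)
  fix x y assume xy: "x \<in> paths" "y \<in> paths" "floor_node x = floor_node y"
  have zero: "pos x (t n) = 0 \<longleftrightarrow> pos y (t n) = 0" for n
    using floor_node_zero_iff xy by metis
  show "x = y"
  proof (cases "\<forall>n. pos x (t n) = 0")
    case True
    then have "x = xmin"
      by (intro min_path_of_pos_zero[OF xy(1) _ t_increasing]) simp
    moreover have "y = xmin"
      using True zero by (intro min_path_of_pos_zero[OF xy(2) _ t_increasing]) simp
    ultimately show ?thesis
      by simp
  next
    case False
    then obtain n0 where n0: "pos x (t n0) \<noteq> 0"
      by blast
    have "x i = y i" for i
    proof -
      let ?n = "max n0 (Suc i)"
      have "pos x (t ?n) \<noteq> 0"
        using n0 pos_zero_mono[OF xy(1) _ t_mono[of n0 ?n]] by fastforce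
      then have "src (x (t ?n)) = src (y (t ?n)) \<and> pos x (t ?n) = pos y (t ?n)"
        using floor_node_inject[OF xy(1,2)] xy(3) by simp
      moreover have "i < t ?n"
        using t_increasing[of ?n] by auto
      ultimately show ?thesis
        using pos_inject[OF xy(1,2)] by blast
    qed
    then show ?thesis
      by blast
  qed
qed

theorem gm_conjugate:
  "topologically_conjugate (bd_path_space B) (bd_vershik B) (cov_limit_space gm) (cov_limit_map gm)"
proof (rule vershik_conjugate_cov_limit[where K = floor_node])
  show "\<exists>m. \<forall>x y. (\<forall>i<m. x i = y i) \<longrightarrow> floor_node x n = floor_node y n" for n
  proof (intro exI allI impI)
    fix x y :: "nat \<Rightarrow> 'e" assume "\<forall>i<Suc (t n). x i = y i"
    then show "floor_node x n = floor_node y n"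
      using pos_cong[of "t n" x y] by (simp add: floor_node_def)
  qed
  show "(floor_node x n, floor_node (bd_vershik B x) n) \<in> parcs (cov_graph gm n)" if "x \<in> paths" for x n
    using that floor_node_vershik[OF that] by simp
qed (auto simp: gm_is_covering inj_floor_node project_floor_node)

end

text \<open>
  Given \<open>t n\<close>, the bound \<open>k\<close> holds at infinitely many levels, and each of the other conditions on
  \<open>t (Suc n)\<close> from some level on.
\<close>

lemma (in proper_bratteli) good_levels_exist:
  fixes k :: nat
  assumes "x \<in> paths" "y \<in> paths" "x \<noteq> y" and small: "\<exists>\<^sub>\<infinity>n. card (V n) \<le> k"
  shows "\<exists>t. t 0 = 0 \<and> (\<forall>n. t n < t (Suc n) \<and> (\<forall>v\<in>V (t (Suc n)). 2 \<le> height (t (Suc n)) v) \<and>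
    (\<forall>x\<in>paths. pos x (t (Suc n)) = 0 \<longrightarrow> src (x (t n)) = src (xmin (t n))) \<and>
    connected_levels (t n) (t (Suc n)) \<and> card (V (t (Suc n))) \<le> k)"
proof -
  let ?Q = "\<lambda>m n. m < n \<and> (\<forall>v\<in>V n. 2 \<le> height n v) \<and>
    (\<forall>x\<in>paths. pos x n = 0 \<longrightarrow> src (x m) = src (xmin m)) \<and>
    connected_levels m n \<and> card (V n) \<le> k"
  have step: "\<exists>n. ?Q m n" for m
  proof -
    obtain M1 where M1: "\<And>n v. M1 \<le> n \<Longrightarrow> v \<in> V n \<Longrightarrow> 2 \<le> height n v"
      using eventually_tall[OF assms(1-3)] by blast
    obtain M2 where M2: "\<And>n x. M2 \<le> n \<Longrightarrow> x \<in> paths \<Longrightarrow> pos x n = 0 \<Longrightarrow> src (x m) = src (xmin m)"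
      using eventually_ground_floor_over_xmin by blast
    obtain M3 where M3: "m < M3" "\<And>n. M3 \<le> n \<Longrightarrow> connected_levels m n"
      using simple_eventually_connected[OF simple] by blast
    obtain n where "max M1 (max M2 M3) < n" "card (V n) \<le> k"
      using small unfolding INFM_nat by blast
    then have n: "M1 \<le> n" "M2 \<le> n" "M3 \<le> n" "m < n" "card (V n) \<le> k"
      using M3(1) by auto
    then show ?thesis
      using M1[OF n(1)] M2[OF n(2)] M3(2)[OF n(3)] by blast
  qed
  have "\<exists>t. \<forall>n. (n = 0 \<longrightarrow> t n = 0) \<and> ?Q (t n) (t (Suc n))"
    by (rule dependent_nat_choice) (use step in auto)
  then show ?thesis
    by blast
qed

lemma INFM_le_of_liminf:
  assumes "liminf (\<lambda>n. enat (a n)) = enat k"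
  shows "\<exists>\<^sub>\<infinity>n. a n \<le> k"
proof (rule ccontr)
  assume "\<not> ?thesis"
  then have "eventually (\<lambda>n. enat (Suc k) \<le> enat (a n)) sequentially"
    by (simp add: not_frequently cofinite_eq_sequentially not_le Suc_le_eq)
  then have "enat (Suc k) \<le> liminf (\<lambda>n. enat (a n))"
    by (rule Liminf_bounded)
  then show False
    using assms by simp
qed

text \<open>
  The towers grow because a Cantor set has two points, so that there are two different paths.
\<close>

theorem gm_covering_of_bratteli:
  fixes B :: "('v :: countable, 'e) ordered_bratteli_diagram"
  assumes "properly_ordered B" "bd_rank B \<noteq> \<infinity>" "cantor_set X"
    and conj: "topologically_conjugate (bd_path_space B) (bd_vershik B) X f"
  shows "\<exists>C :: nat gm_covering. is_gm_covering C \<and> gm_simple C \<and> gm_rank C \<le> bd_rank B \<and>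
    topologically_conjugate (cov_limit_space C) (cov_limit_map C) X f"
proof -
  interpret proper_bratteli B
    using assms(1) by unfold_locales (simp_all add: properly_ordered_def)
  let ?P = "product_topology (\<lambda>_::nat. discrete_topology (UNIV :: bool set)) UNIV"
  obtain h where "homeomorphic_map (bd_path_space B) X h"
    using conj by (auto simp: topologically_conjugate_def)
  moreover obtain g where "homeomorphic_map X ?P g"
    using assms(3) by (auto simp: cantor_set_def homeomorphic_space)
  ultimately have "homeomorphic_map (bd_path_space B) ?P (g \<circ> h)"
    by (rule homeomorphic_map_compose)
  then have "(g \<circ> h) ` paths = UNIV"
    using homeomorphic_imp_surjective_map by fastforce
  then have "(\<lambda>_. True) \<in> (g \<circ> h) ` paths" "(\<lambda>_. False) \<in> (g \<circ> h) ` paths"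
    by simp_all
  then obtain x y where xy: "x \<in> paths" "y \<in> paths"
    and gx: "(\<lambda>_. True) = (g \<circ> h) x" and gy: "(\<lambda>_. False) = (g \<circ> h) y"
    by blast
  have "x \<noteq> y"
  proof
    assume "x = y"
    then have "(\<lambda>_::nat. True) = (\<lambda>_. False)"
      using gx gy by simp
    then show False
      by (metis (full_types))
  qed
  obtain k where k: "bd_rank B = enat k"
    using assms(2) by auto
  then have "\<exists>\<^sub>\<infinity>n. card (V n) \<le> k"
    by (intro INFM_le_of_liminf) (simp add: bd_rank_def)
  from good_levels_exist[OF xy \<open>x \<noteq> y\<close> this]
  obtain t where t: "t 0 = 0" "\<And>n. t n < t (Suc n)" "\<And>n v. v \<in> V (t (Suc n)) \<Longrightarrow> 2 \<le> height (t (Suc n)) v"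
    "\<And>n x. x \<in> paths \<Longrightarrow> pos x (t (Suc n)) = 0 \<Longrightarrow> src (x (t n)) = src (xmin (t n))"
    "\<And>n. connected_levels (t n) (t (Suc n))" "\<And>n. card (V (t (Suc n))) \<le> k"
    by blast
  interpret collapsed_towers B t
    by unfold_locales (fact t)+
  have "gm_rank gm \<le> liminf (\<lambda>n::nat. enat k)"
    unfolding gm_rank_def
  proof (rule Liminf_mono)
    have "enat (gm_num gm n) \<le> enat k" if "1 \<le> n" for n
      using t(6)[of "n - 1"] that by simp
    then show "\<forall>\<^sub>F n in sequentially. enat (gm_num gm n) \<le> enat k"
      unfolding eventually_sequentially by blast
  qed
  then have "gm_rank gm \<le> bd_rank B"
    using k by (simp add: Liminf_const)
  moreover have "topologically_conjugate (cov_limit_space gm) (cov_limit_map gm) X f"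
    by (rule topologically_conjugate_trans[OF topologically_conjugate_sym[OF gm_conjugate] conj])
      (use vershik_floor(1) in auto)
  ultimately show ?thesis
    using gm_is_gm_covering gm_is_simple by blast
qed

theorem corollary6p6:
  fixes X :: "'a topology" and f :: "'a \<Rightarrow> 'a"
  assumes "cantor_set X"
    and "homeomorphic_map X X f"
    and "minimal_map X f"
  shows "bratteli_topological_rank X f = gm_topological_rank X f"
proof (rule antisym)
  show "bratteli_topological_rank X f \<le> gm_topological_rank X f"
    unfolding gm_topological_rank_def
  proof (rule Inf_greatest, clarify)
    fix C :: "nat gm_covering"
    assume "is_gm_covering C" "gm_simple C"
      "topologically_conjugate (cov_limit_space C) (cov_limit_map C) X f"
    then show "bratteli_topological_rank X f \<le> gm_rank C"
      using bratteli_of_gm_covering[OF _ _ assms(2)] unfolding bratteli_topological_rank_def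
      by (metis (mono_tags, lifting) Inf_lower mem_Collect_eq)
  qed
  show "gm_topological_rank X f \<le> bratteli_topological_rank X f"
    unfolding bratteli_topological_rank_def
  proof (rule Inf_greatest, clarify)
    fix B :: "(nat, nat) ordered_bratteli_diagram"
    assume B: "properly_ordered B" "topologically_conjugate (bd_path_space B) (bd_vershik B) X f"
    show "gm_topological_rank X f \<le> bd_rank B"
    proof (cases "bd_rank B = \<infinity>")
      case False
      then obtain C :: "nat gm_covering" where C: "is_gm_covering C" "gm_simple C"
        "gm_rank C \<le> bd_rank B" "topologically_conjugate (cov_limit_space C) (cov_limit_map C) X f"
        using gm_covering_of_bratteli[OF B(1) _ assms(1) B(2)] by blast
      have "gm_topological_rank X f \<le> gm_rank C"
        unfolding gm_topological_rank_def using C by (intro Inf_lower) blast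
      then show ?thesis
        using C(3) by (rule order_trans)
    qed simp
  qed
qed

end
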